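(* Let $s\in\mathbb{N}$, $m\ge s-1$, $n=9m$, $w_1,\dots,w_s\in\mathbb{C}$, and let $x\in X(w_1,\dots,w_s)$. Suppose one observes $y_t=x_t+\sigma\xi_t$ for $t\in\{-2n,\dots,2n\}$, where $\sigma\ge0$ and the $\xi_t$ are i.i.d. standard complex Gaussian $\mathbb{C}\mathcal{N}(0,1)$. Let $\widehat\varphi\in\mathbb{C}_n(\mathbb{Z})$ be an optimal solution of $$\min_{\varphi\in\mathbb{C}_n(\mathbb{Z})}\Big\{\|\varphi*y-y\|_{n,2}^2:\ \max\{\|\mathcal{F}_n[\varphi]\|_1,\,18s\|\mathcal{F}_n[\varphi]\|_\infty\}\le\frac{18\mathsf{c}_\star s}{\sqrt{2n+1}}\Big\},\qquad \mathsf{c}_\star=2.16\pi^2+6.$$ Then for every $\delta\in(0,1)$, with probability at least $1-\delta$, $$\|\widehat\varphi*y-x\|_{n,2}^2\le 80\mathsf{c}_\star^2\sigma^2\big(3s\log(2n+1)+10s+\log(\delta^{-1})\big)\log^2(9e^4s).$$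
   Context: $\mathbb{C}(\mathbb{Z})$: two-sided complex sequences; $\mathbb{C}_n(\mathbb{Z})$: those with $x_t=0$ for $|t|>n$. $(\Delta x)_t=x_{t-1}$. $X(w_1,\dots,w_s)=\{x\in\mathbb{C}(\mathbb{Z}):\mathsf{f}(\Delta)x=0\}$ with $\mathsf{f}(z)=\prod_{k=1}^s(1-w_kz)$. Convolution $(u*v)_t=\sum_\tau u_\tau v_{t-\tau}$. Seminorm $\|u\|_{n,2}=(\sum_{|t|\le n}|u_t|^2)^{1/2}$. DFT: $(\mathcal{F}_n[u])_k=(2n+1)^{-1/2}\sum_{|\tau|\le n}\exp(-i2\pi k\tau/(2n+1))u_\tau$, $k=0,\dots,2n$, with usual $\ell_p$-norms on $\mathbb{C}^{2n+1}$. *)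

theory Defs
  imports "HOL-Probability.Probability" "HOL-Computational_Algebra.Polynomial"
begin

definition fpoly :: "nat \<Rightarrow> (nat \<Rightarrow> complex) \<Rightarrow> complex poly" where
  "fpoly s w = (\<Prod>k<s. [:1, - w k:])"

(* (p(Delta) x)_t = sum_j coeff p j * x_{t-j}, since (Delta^j x)_t = x_{t-j} *)
definition poly_shift :: "complex poly \<Rightarrow> (int \<Rightarrow> complex) \<Rightarrow> (int \<Rightarrow> complex)" where
  "poly_shift p x = (\<lambda>t. \<Sum>j\<le>degree p. coeff p j * x (t - int j))"

definition Xset :: "nat \<Rightarrow> (nat \<Rightarrow> complex) \<Rightarrow> (int \<Rightarrow> complex) set" where
  "Xset s w = {x. poly_shift (fpoly s w) x = (\<lambda>_. 0)}"

definition Cn :: "nat \<Rightarrow> (int \<Rightarrow> complex) set" where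
  "Cn n = {u. \<forall>t. \<bar>t\<bar> > int n \<longrightarrow> u t = 0}"

definition conv :: "(int \<Rightarrow> complex) \<Rightarrow> (int \<Rightarrow> complex) \<Rightarrow> (int \<Rightarrow> complex)" where
  "conv u v = (\<lambda>t. \<Sum>\<^sub>\<infinity>\<tau>. u \<tau> * v (t - \<tau>))"

definition seminorm2 :: "nat \<Rightarrow> (int \<Rightarrow> complex) \<Rightarrow> real" where
  "seminorm2 n u = sqrt (\<Sum>t\<in>{- int n..int n}. (cmod (u t))\<^sup>2)"

definition dft :: "nat \<Rightarrow> (int \<Rightarrow> complex) \<Rightarrow> nat \<Rightarrow> complex" where
  "dft n u k = (1 / sqrt (2 * real n + 1)) *
     (\<Sum>\<tau>\<in>{- int n..int n}. exp (- \<i> * 2 * pi * of_nat k * of_int \<tau> / (2 * of_nat n + 1)) * u \<tau>)"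

definition dft_l1 :: "nat \<Rightarrow> (int \<Rightarrow> complex) \<Rightarrow> real" where
  "dft_l1 n u = (\<Sum>k\<le>2*n. cmod (dft n u k))"

definition dft_linf :: "nat \<Rightarrow> (int \<Rightarrow> complex) \<Rightarrow> real" where
  "dft_linf n u = Max ((\<lambda>k. cmod (dft n u k)) ` {..2*n})"

definition c_star :: real where
  "c_star = 2.16 * pi\<^sup>2 + 6"

definition feasible :: "nat \<Rightarrow> nat \<Rightarrow> (int \<Rightarrow> complex) \<Rightarrow> bool" where
  "feasible s n \<phi> \<longleftrightarrow> \<phi> \<in> Cn n \<and>
     max (dft_l1 n \<phi>) (18 * real s * dft_linf n \<phi>) \<le> 18 * c_star * real s / sqrt (2 * real n + 1)"

definition optimal :: "nat \<Rightarrow> nat \<Rightarrow> (int \<Rightarrow> complex) \<Rightarrow> (int \<Rightarrow> complex) \<Rightarrow> bool" where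
  "optimal s n y \<phi> \<longleftrightarrow> feasible s n \<phi> \<and>
     (\<forall>\<psi>. feasible s n \<psi> \<longrightarrow>
        (seminorm2 n (\<lambda>t. conv \<phi> y t - y t))\<^sup>2 \<le> (seminorm2 n (\<lambda>t. conv \<psi> y t - y t))\<^sup>2)"

definition std_complex_gaussian :: "complex measure" where
  "std_complex_gaussian = density lborel (\<lambda>z. ennreal (exp (- (cmod z)\<^sup>2) / pi))"

end

(*
A maximal orthonormal family in the signals restricted to {-m..m} has at most s members, and averaging
the corresponding projector along its diagonals gives a reproducing filter with spectrum in [0, 1] and
mean spectrum at most s / (2m + 1); it is feasible. Optimality of the estimated filter against this
oracle reduces the loss to the noise projected on the signal space and to quadratic forms of the noise
in a feasible filter. Both are controlled on the frequency grid of size 2 (2n + 1), where the spectrum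
of a feasible filter is dominated by a combination of Dirichlet kernels with coefficients in a capped
simplex. By convexity only sets of at most 18 s kernels matter; their sum is at most 3 + log (18 s)
pointwise, because the kernels decay like the reciprocals of the odd integers, and a union bound over
these sets costs 18 s log (2n + 1).
*)
theory Submission
  imports Defs
begin

section \<open>Quadratic forms of complex Gaussian vectors\<close>

text \<open>The estimated filter depends on the noise, so the stochastic bounds must hold for all
  feasible filters on one event; the oracle inequality is then deterministic and covers every
  minimizer at once. The doubled grid is forced by the convolution: a filter on -n..n meets noise on
  -2n..2n, and on the output window -n..n the result agrees with circular convolution modulo 4n+2.
  Even frequencies of that modulus are those of the DFT in the constraints; the odd ones lie midway,
  where the spectrum has to be interpolated, and this interpolation produces the Dirichlet kernels.
  The constraints, divided by \<open>c_star\<close>, say that the moduli of the unnormalized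
  spectrum are at most 1 and sum to at most 18 s. This is the capped simplex, and 18 s the size of
  its extreme sets. The squared logarithm has two sources: the pointwise bound on the interpolated
  spectrum, pulled out of the quadratic term, and the deviation scale of the weighted noise
  energies, which is the largest weight.\<close>

lemma nn_integral_exp_quadratic:
  fixes a c :: real
  assumes "c > 0"
  shows "(\<integral>\<^sup>+x. ennreal (exp (2 * a * x - c * x\<^sup>2)) \<partial>lborel) = ennreal (sqrt (pi / c) * exp (a\<^sup>2 / c))"
proof -
  have eq: "exp (2 * a * x - c * x\<^sup>2)
      = (sqrt (pi / c) * exp (a\<^sup>2 / c)) * normal_density (a / c) (sqrt (1 / (2 * c))) x" for x
  proof -
    have "2 * a * x - c * x\<^sup>2 = a\<^sup>2 / c + - (x - a / c)\<^sup>2 * c"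
      using assms by (simp add: power2_eq_square field_simps)
    then have "exp (2 * a * x - c * x\<^sup>2) = exp (a\<^sup>2 / c) * exp (- (x - a / c)\<^sup>2 * c)"
      by (simp only: exp_add)
    moreover have "(sqrt (1 / (2 * c)))\<^sup>2 = 1 / (2 * c)"
      using assms by simp
    moreover have "2 * pi * (1 / (2 * c)) = pi / c" "2 * (1 / (2 * c)) = 1 / c"
      by simp_all
    moreover have "sqrt (pi / c) \<noteq> 0" using assms by simp
    ultimately show ?thesis
      unfolding normal_density_def by (simp del: real_sqrt_eq_zero_cancel_iff)
  qed
  have pos: "sqrt (1 / (2 * c)) > 0" using assms by simp
  interpret N: prob_space "density lborel (\<lambda>x. ennreal (normal_density (a / c) (sqrt (1 / (2 * c))) x))"
    by (rule prob_space_normal_density[OF pos])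
  have one: "(\<integral>\<^sup>+x. ennreal (normal_density (a / c) (sqrt (1 / (2 * c))) x) \<partial>lborel) = 1"
    using N.emeasure_space_1 by (simp add: emeasure_density)
  show ?thesis
    unfolding eq using assms
    by (subst ennreal_mult) (auto simp: nn_integral_cmult one)
qed

lemma sets_std_complex_gaussian [simp, measurable_cong]: "sets std_complex_gaussian = sets borel"
  by (simp add: std_complex_gaussian_def)

lemma space_std_complex_gaussian [simp]: "space std_complex_gaussian = UNIV"
  by (simp add: std_complex_gaussian_def)

text \<open>The density factors into real and imaginary parts, each a completed square with
  curvature \<open>1 - l\<close>. Later uses are \<open>l = 0\<close> (exponentials of linear
  forms), \<open>a = 0\<close> (exponentials of squares) and both zero (total mass one).\<close>

lemma std_complex_gaussian_mgf:
  fixes a :: complex and l :: real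
  assumes "l < 1"
  shows "(\<integral>\<^sup>+z. ennreal (exp (2 * Re (a * z) + l * (cmod z)\<^sup>2)) \<partial>std_complex_gaussian)
    = ennreal (exp ((cmod a)\<^sup>2 / (1 - l)) / (1 - l))"
proof -
  \<comment> \<open>Lebesgue measure on the complex plane is a product over \<open>Basis\<close>,
    that is over 1 and \<open>\<i>\<close>, hence a factor per basis vector. The Gaussian weight is
    already included, and the sign of \<open>Im a\<close> comes from the real part of a
    product.\<close>
  define f :: "complex \<Rightarrow> real \<Rightarrow> ennreal" where
    "f b y = ennreal (exp (2 * (if b = 1 then Re a else - Im a) * y - (1 - l) * y\<^sup>2))" for b y
  have fm: "f b \<in> borel_measurable borel" for b
    unfolding f_def by measurable
  have ne: "(1::complex) \<noteq> \<i>" by (simp add: complex_eq_iff)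
  have c: "1 - l > 0" using assms by simp
  have eq: "ennreal (exp (- (cmod z)\<^sup>2) / pi) * ennreal (exp (2 * Re (a * z) + l * (cmod z)\<^sup>2))
      = ennreal (1 / pi) * (\<Prod>b\<in>Basis. f b (z \<bullet> b))" for z
  proof -
    have "(\<Prod>b\<in>Basis. f b (z \<bullet> b)) = f 1 (Re z) * f \<i> (Im z)"
      using ne by (simp add: Basis_complex_def)
    also have "\<dots> = ennreal (exp (2 * Re (a * z) + l * (cmod z)\<^sup>2 - (cmod z)\<^sup>2))"
      using ne unfolding f_def
      by (simp flip: ennreal_mult exp_add) (simp add: cmod_power2 algebra_simps)
    finally show ?thesis
      by (simp flip: ennreal_mult add: exp_diff exp_minus divide_inverse mult_ac)
  qed
  have sq: "sqrt (pi / (1 - l)) * x * (sqrt (pi / (1 - l)) * y) = pi * (x * y) / (1 - l)" for x y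
  proof -
    have "sqrt (pi / (1 - l)) * sqrt (pi / (1 - l)) = pi / (1 - l)"
      using c by simp
    then show ?thesis by (metis (no_types) mult.assoc mult.left_commute times_divide_eq_left)
  qed
  have i1: "(\<integral>\<^sup>+y. f 1 y \<partial>lborel) = ennreal (sqrt (pi / (1 - l)) * exp ((Re a)\<^sup>2 / (1 - l)))"
    using nn_integral_exp_quadratic[OF c, of "Re a"] by (simp add: f_def)
  have i2: "(\<integral>\<^sup>+y. f \<i> y \<partial>lborel) = ennreal (sqrt (pi / (1 - l)) * exp ((Im a)\<^sup>2 / (1 - l)))"
    using ne nn_integral_exp_quadratic[OF c, of "- Im a"] by (simp add: f_def)
  have "(\<integral>\<^sup>+z. ennreal (exp (2 * Re (a * z) + l * (cmod z)\<^sup>2)) \<partial>std_complex_gaussian)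
      = (\<integral>\<^sup>+z. ennreal (exp (- (cmod z)\<^sup>2) / pi) * ennreal (exp (2 * Re (a * z) + l * (cmod z)\<^sup>2)) \<partial>lborel)"
    unfolding std_complex_gaussian_def by (subst nn_integral_density) auto
  also have "\<dots> = (\<integral>\<^sup>+z. ennreal (1 / pi) * (\<Prod>b\<in>Basis. f b (z \<bullet> b)) \<partial>lborel)"
    by (simp only: eq)
  also have "\<dots> = ennreal (1 / pi) * (\<Prod>b\<in>Basis. \<integral>\<^sup>+y. f b y \<partial>lborel)"
    using fm by (subst nn_integral_cmult) (auto simp: nn_integral_lborel_prod)
  also have "(\<Prod>b\<in>(Basis::complex set). \<integral>\<^sup>+y. f b y \<partial>lborel)
      = ennreal (pi / (1 - l) * exp ((cmod a)\<^sup>2 / (1 - l)))"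
    using ne c by (simp add: Basis_complex_def i1 i2 flip: ennreal_mult)
      (simp add: cmod_power2 add_divide_distrib exp_add sq)
  also have "ennreal (1 / pi) * \<dots> = ennreal (exp ((cmod a)\<^sup>2 / (1 - l)) / (1 - l))"
    using c by (simp flip: ennreal_mult add: field_simps)
  finally show ?thesis .
qed

lemma prob_space_std_complex_gaussian: "prob_space std_complex_gaussian"
proof
  show "emeasure std_complex_gaussian (space std_complex_gaussian) = 1"
    using std_complex_gaussian_mgf[of 0 0] by (simp add: std_complex_gaussian_def emeasure_density)
qed

text \<open>Bounds the moment generating function of a squared Gaussian by an exponential of its
  weight. Restricting to weights up to 1/2 costs the factor 2 that later stands before the
  trace.\<close>

lemma inverse_one_minus_le_exp:
  fixes x :: real
  assumes "0 \<le> x" "x \<le> 1 / 2"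
  shows "1 / (1 - x) \<le> exp (2 * x)"
proof -
  have "x\<^sup>2 \<le> x / 2"
    using mult_left_mono[OF assms(2) assms(1)] by (simp add: power2_eq_square)
  then have "- 2 * x \<le> ln (1 - x)"
    using ln_one_minus_pos_lower_bound[OF assms] by simp
  then have "exp (- 2 * x) \<le> 1 - x"
    using assms by (simp add: ln_ge_iff)
  then have "1 / (1 - x) \<le> 1 / exp (- 2 * x)"
    using assms by (intro divide_left_mono) auto
  then show ?thesis by (simp add: exp_minus field_simps)
qed

text \<open>
  Each factor \<open>exp (l j * (cmod (y j))\<^sup>2)\<close> is written as a Gaussian average of exponentials that are
  linear in \<open>y j\<close>; after exchanging the two averages the roles of rows and columns are swapped, so
  that no diagonalization and no unitary invariance of the Gaussian law is needed.
\<close>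
lemma (in prob_space) gaussian_quadratic_mgf:
  fixes X :: "'i \<Rightarrow> 'a \<Rightarrow> complex" and U :: "'j \<Rightarrow> 'i \<Rightarrow> complex" and l :: "'j \<Rightarrow> real"
  assumes fin: "finite T" "finite J"
    and indep: "indep_vars (\<lambda>_. borel) X T"
    and gauss: "\<And>t. t \<in> T \<Longrightarrow> distr M borel (X t) = std_complex_gaussian"
    and l: "\<And>j. j \<in> J \<Longrightarrow> 0 \<le> l j \<and> l j \<le> 1 / 2"
    and contr: "\<And>g. (\<Sum>t\<in>T. (cmod (\<Sum>j\<in>J. g j * U j t))\<^sup>2) \<le> (\<Sum>j\<in>J. (cmod (g j))\<^sup>2)"
  shows "(\<integral>\<^sup>+\<omega>. ennreal (exp (\<Sum>j\<in>J. l j * (cmod (\<Sum>t\<in>T. U j t * X t \<omega>))\<^sup>2)) \<partial>M)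
    \<le> ennreal (exp (2 * (\<Sum>j\<in>J. l j)))"
proof -
  let ?G = "std_complex_gaussian"
  interpret G: prob_space ?G by (rule prob_space_std_complex_gaussian)
  interpret P: product_prob_space "\<lambda>_. ?G" J ..
  interpret MP: pair_prob_space M "Pi\<^sub>M J (\<lambda>_. ?G)" ..
  have lm: "(\<lambda>z. ennreal (exp (2 * Re (b * z)))) \<in> borel_measurable ?G" for b
    by measurable
  have qm: "(\<lambda>z. ennreal (exp (r * (cmod z)\<^sup>2))) \<in> borel_measurable ?G" for r
    by measurable
  have X[measurable]: "X t \<in> borel_measurable M" if "t \<in> T" for t
    using indep that by (auto simp: indep_vars_def)
  \<comment> \<open>The square root of \<open>l j\<close> sits in \<open>a j\<close>, so that
    \<open>exp\<close> of its squared modulus is a Gaussian average of exponentials linear in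
    \<open>a j\<close>. In the same bilinear form, \<open>h t\<close> is the coefficient of
    \<open>X t\<close>.\<close>
  define a where "a j \<omega> = complex_of_real (sqrt (l j)) * (\<Sum>t\<in>T. U j t * X t \<omega>)" for j \<omega>
  define h where "h t g = (\<Sum>j\<in>J. (complex_of_real (sqrt (l j)) * g j) * U j t)" for t and g :: "'j \<Rightarrow> complex"
  have am[measurable]: "a j \<in> borel_measurable M" for j
    unfolding a_def by measurable
  have gm[measurable]: "(\<lambda>g. g j) \<in> borel_measurable (Pi\<^sub>M J (\<lambda>_. ?G))" if "j \<in> J" for j
    using measurable_component_singleton[OF that, of "\<lambda>_. ?G"]
    by (simp cong: measurable_cong_sets)
  have hm[measurable]: "h t \<in> borel_measurable (Pi\<^sub>M J (\<lambda>_. ?G))" for t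
    unfolding h_def by measurable
  have swap: "(\<Sum>j\<in>J. a j \<omega> * g j) = (\<Sum>t\<in>T. h t g * X t \<omega>)" for \<omega> g
    unfolding a_def h_def sum_distrib_left sum_distrib_right
    by (subst sum.swap) (simp add: mult_ac)
  have lin: "(\<integral>\<^sup>+z. ennreal (exp (2 * Re (b * z))) \<partial>?G) = ennreal (exp ((cmod b)\<^sup>2))" for b
    using std_complex_gaussian_mgf[of 0 b] by simp
  have "(\<integral>\<^sup>+\<omega>. ennreal (exp (\<Sum>j\<in>J. l j * (cmod (\<Sum>t\<in>T. U j t * X t \<omega>))\<^sup>2)) \<partial>M)
      = (\<integral>\<^sup>+\<omega>. (\<Prod>j\<in>J. ennreal (exp ((cmod (a j \<omega>))\<^sup>2))) \<partial>M)"
  proof (rule nn_integral_cong)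
    fix \<omega>
    have "(\<Sum>j\<in>J. l j * (cmod (\<Sum>t\<in>T. U j t * X t \<omega>))\<^sup>2) = (\<Sum>j\<in>J. (cmod (a j \<omega>))\<^sup>2)"
      using l by (intro sum.cong) (auto simp: a_def norm_mult power_mult_distrib)
    then show "ennreal (exp (\<Sum>j\<in>J. l j * (cmod (\<Sum>t\<in>T. U j t * X t \<omega>))\<^sup>2))
        = (\<Prod>j\<in>J. ennreal (exp ((cmod (a j \<omega>))\<^sup>2)))"
      by (simp add: prod_ennreal exp_sum fin)
  qed
  also have "\<dots> = (\<integral>\<^sup>+\<omega>. (\<integral>\<^sup>+g. (\<Prod>j\<in>J. ennreal (exp (2 * Re (a j \<omega> * g j)))) \<partial>Pi\<^sub>M J (\<lambda>_. ?G)) \<partial>M)"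
  proof (rule nn_integral_cong)
    fix \<omega>
    have "(\<integral>\<^sup>+g. (\<Prod>j\<in>J. ennreal (exp (2 * Re (a j \<omega> * g j)))) \<partial>Pi\<^sub>M J (\<lambda>_. ?G))
        = (\<Prod>j\<in>J. \<integral>\<^sup>+z. ennreal (exp (2 * Re (a j \<omega> * z))) \<partial>?G)"
      by (rule P.product_nn_integral_prod[where f = "\<lambda>j z. ennreal (exp (2 * Re (a j \<omega> * z)))"])
        (rule fin, rule lm)
    then show "(\<Prod>j\<in>J. ennreal (exp ((cmod (a j \<omega>))\<^sup>2)))
        = (\<integral>\<^sup>+g. (\<Prod>j\<in>J. ennreal (exp (2 * Re (a j \<omega> * g j)))) \<partial>Pi\<^sub>M J (\<lambda>_. ?G))"
      by (simp only: lin)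
  qed
  also have "\<dots> = (\<integral>\<^sup>+g. (\<integral>\<^sup>+\<omega>. (\<Prod>j\<in>J. ennreal (exp (2 * Re (a j \<omega> * g j)))) \<partial>M) \<partial>Pi\<^sub>M J (\<lambda>_. ?G))"
    by (rule MP.Fubini'[symmetric]) (simp add: split_beta', measurable)
  also have "\<dots> = (\<integral>\<^sup>+g. (\<integral>\<^sup>+\<omega>. (\<Prod>t\<in>T. ennreal (exp (2 * Re (h t g * X t \<omega>)))) \<partial>M) \<partial>Pi\<^sub>M J (\<lambda>_. ?G))"
  proof (intro nn_integral_cong)
    fix g \<omega>
    have "(\<Sum>j\<in>J. 2 * Re (a j \<omega> * g j)) = (\<Sum>t\<in>T. 2 * Re (h t g * X t \<omega>))"
      using arg_cong[OF swap[of \<omega> g], of Re] unfolding Re_sum sum_distrib_left[symmetric] by (rule arg_cong)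
    then show "(\<Prod>j\<in>J. ennreal (exp (2 * Re (a j \<omega> * g j))))
        = (\<Prod>t\<in>T. ennreal (exp (2 * Re (h t g * X t \<omega>))))"
      by (simp add: prod_ennreal fin flip: exp_sum)
  qed
  also have "\<dots> = (\<integral>\<^sup>+g. (\<Prod>t\<in>T. ennreal (exp ((cmod (h t g))\<^sup>2))) \<partial>Pi\<^sub>M J (\<lambda>_. ?G))"
  proof (rule nn_integral_cong)
    fix g
    have "indep_vars (\<lambda>_. borel) (\<lambda>t \<omega>. ennreal (exp (2 * Re (h t g * X t \<omega>)))) T"
      by (rule indep_vars_compose2[OF indep]) simp
    then have "(\<integral>\<^sup>+\<omega>. (\<Prod>t\<in>T. ennreal (exp (2 * Re (h t g * X t \<omega>)))) \<partial>M)
        = (\<Prod>t\<in>T. \<integral>\<^sup>+\<omega>. ennreal (exp (2 * Re (h t g * X t \<omega>))) \<partial>M)"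
      by (intro indep_vars_nn_integral fin) auto
    also have "\<dots> = (\<Prod>t\<in>T. ennreal (exp ((cmod (h t g))\<^sup>2)))"
    proof (rule prod.cong)
      fix t assume t: "t \<in> T"
      have "(\<integral>\<^sup>+\<omega>. ennreal (exp (2 * Re (h t g * X t \<omega>))) \<partial>M)
          = (\<integral>\<^sup>+z. ennreal (exp (2 * Re (h t g * z))) \<partial>distr M borel (X t))"
        using t by (subst nn_integral_distr) auto
      then show "(\<integral>\<^sup>+\<omega>. ennreal (exp (2 * Re (h t g * X t \<omega>))) \<partial>M) = ennreal (exp ((cmod (h t g))\<^sup>2))"
        by (simp only: gauss[OF t] lin)
    qed simp
    finally show "(\<integral>\<^sup>+\<omega>. (\<Prod>t\<in>T. ennreal (exp (2 * Re (h t g * X t \<omega>)))) \<partial>M)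
        = (\<Prod>t\<in>T. ennreal (exp ((cmod (h t g))\<^sup>2)))" .
  qed
  also have "\<dots> \<le> (\<integral>\<^sup>+g. (\<Prod>j\<in>J. ennreal (exp (l j * (cmod (g j))\<^sup>2))) \<partial>Pi\<^sub>M J (\<lambda>_. ?G))"
  proof (rule nn_integral_mono)
    fix g
    \<comment> \<open>Contractivity enters here, on the transposed side: it replaces the coupled
      forms \<open>h t g\<close> by the independent coordinates of \<open>g\<close>, and the
      integral factors.\<close>
    have "(\<Sum>t\<in>T. (cmod (h t g))\<^sup>2) \<le> (\<Sum>j\<in>J. (cmod (complex_of_real (sqrt (l j)) * g j))\<^sup>2)"
      unfolding h_def by (rule contr)
    also have "\<dots> = (\<Sum>j\<in>J. l j * (cmod (g j))\<^sup>2)"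
      using l by (intro sum.cong) (auto simp: norm_mult power_mult_distrib)
    finally show "(\<Prod>t\<in>T. ennreal (exp ((cmod (h t g))\<^sup>2))) \<le> (\<Prod>j\<in>J. ennreal (exp (l j * (cmod (g j))\<^sup>2)))"
      by (simp add: prod_ennreal fin flip: exp_sum)
  qed
  also have "\<dots> = (\<Prod>j\<in>J. \<integral>\<^sup>+z. ennreal (exp (l j * (cmod z)\<^sup>2)) \<partial>?G)"
    by (rule P.product_nn_integral_prod[where f = "\<lambda>j z. ennreal (exp (l j * (cmod z)\<^sup>2))"])
      (rule fin, rule qm)
  also have "\<dots> = (\<Prod>j\<in>J. ennreal (1 / (1 - l j)))"
  proof (rule prod.cong)
    fix j assume "j \<in> J"
    then have "l j < 1" using l[of j] by auto
    then show "(\<integral>\<^sup>+z. ennreal (exp (l j * (cmod z)\<^sup>2)) \<partial>?G) = ennreal (1 / (1 - l j))"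
      using std_complex_gaussian_mgf[of "l j" 0] by simp
  qed simp
  also have "\<dots> \<le> (\<Prod>j\<in>J. ennreal (exp (2 * l j)))"
    using l by (intro prod_mono_ennreal ennreal_leI inverse_one_minus_le_exp) auto
  also have "\<dots> = ennreal (exp (2 * (\<Sum>j\<in>J. l j)))"
    by (simp add: prod_ennreal sum_distrib_left exp_sum fin)
  finally show ?thesis .
qed

text \<open>Chernoff's method with exponent \<open>1 / (2 * L)\<close>, which brings the weights
  into the range up to 1/2. Divided by \<open>2 * L\<close>, the threshold is the bound
  \<open>S / L\<close> on the log moment generating function plus \<open>r\<close>.\<close>

lemma (in prob_space) gaussian_quadratic_tail:
  fixes X :: "'i \<Rightarrow> 'a \<Rightarrow> complex" and U :: "'j \<Rightarrow> 'i \<Rightarrow> complex" and w :: "'j \<Rightarrow> real"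
  assumes fin: "finite T" "finite J"
    and indep: "indep_vars (\<lambda>_. borel) X T"
    and gauss: "\<And>t. t \<in> T \<Longrightarrow> distr M borel (X t) = std_complex_gaussian"
    and L: "0 < L"
    and w: "\<And>j. j \<in> J \<Longrightarrow> 0 \<le> w j \<and> w j \<le> L"
    and contr: "\<And>g. (\<Sum>t\<in>T. (cmod (\<Sum>j\<in>J. g j * U j t))\<^sup>2) \<le> (\<Sum>j\<in>J. (cmod (g j))\<^sup>2)"
  shows "prob {\<omega>\<in>space M. (\<Sum>j\<in>J. w j * (cmod (\<Sum>t\<in>T. U j t * X t \<omega>))\<^sup>2) \<ge> 2 * (\<Sum>j\<in>J. w j) + 2 * L * r}
    \<le> exp (- r)"
proof -
  have X[measurable]: "X t \<in> borel_measurable M" if "t \<in> T" for t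
    using indep that by (auto simp: indep_vars_def)
  define l where "l j = w j / (2 * L)" for j
  define Q where "Q \<omega> = (\<Sum>j\<in>J. w j * (cmod (\<Sum>t\<in>T. U j t * X t \<omega>))\<^sup>2)" for \<omega>
  define S where "S = (\<Sum>j\<in>J. w j)"
  have Qm[measurable]: "Q \<in> borel_measurable M" unfolding Q_def by measurable
  have Ql: "(\<Sum>j\<in>J. l j * (cmod (\<Sum>t\<in>T. U j t * X t \<omega>))\<^sup>2) = Q \<omega> / (2 * L)" for \<omega>
    by (simp add: l_def Q_def sum_divide_distrib)
  have Sl: "2 * (\<Sum>j\<in>J. l j) = S / L"
    using L by (simp add: l_def S_def flip: sum_divide_distrib)
  have "(\<integral>\<^sup>+\<omega>. ennreal (exp (\<Sum>j\<in>J. l j * (cmod (\<Sum>t\<in>T. U j t * X t \<omega>))\<^sup>2)) \<partial>M)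
      \<le> ennreal (exp (2 * (\<Sum>j\<in>J. l j)))"
    by (rule gaussian_quadratic_mgf[OF fin indep gauss _ contr])
      (use w L in \<open>auto simp: l_def field_simps\<close>)
  then have mgf: "(\<integral>\<^sup>+\<omega>. ennreal (exp (Q \<omega> / (2 * L))) \<partial>M) \<le> ennreal (exp (S / L))"
    by (simp only: Ql Sl)
  let ?A = "{\<omega>\<in>space M. Q \<omega> \<ge> 2 * S + 2 * L * r}"
  have "emeasure M ?A \<le> emeasure M {\<omega>\<in>space M. 1 \<le> ennreal (exp (- (S / L + r))) * ennreal (exp (Q \<omega> / (2 * L)))}"
  proof (rule emeasure_mono)
    show "?A \<subseteq> {\<omega>\<in>space M. 1 \<le> ennreal (exp (- (S / L + r))) * ennreal (exp (Q \<omega> / (2 * L)))}"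
    proof (intro Collect_mono impI conjI; elim conjE)
      fix \<omega> assume "2 * S + 2 * L * r \<le> Q \<omega>"
      then have "(2 * S + 2 * L * r) / (2 * L) \<le> Q \<omega> / (2 * L)"
        using L by (intro divide_right_mono) auto
      then have "S / L + r \<le> Q \<omega> / (2 * L)"
        using L by (simp add: add_divide_distrib)
      then show "1 \<le> ennreal (exp (- (S / L + r))) * ennreal (exp (Q \<omega> / (2 * L)))"
        by (simp flip: ennreal_mult exp_add)
    qed
  qed measurable
  also have "\<dots> \<le> ennreal (exp (- (S / L + r))) * (\<integral>\<^sup>+\<omega>. ennreal (exp (Q \<omega> / (2 * L))) * indicator (space M) \<omega> \<partial>M)"
    by (rule nn_integral_Markov_inequality) auto
  also have "(\<integral>\<^sup>+\<omega>. ennreal (exp (Q \<omega> / (2 * L))) * indicator (space M) \<omega> \<partial>M)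
      = (\<integral>\<^sup>+\<omega>. ennreal (exp (Q \<omega> / (2 * L))) \<partial>M)"
    by (rule nn_integral_cong) simp
  also have "ennreal (exp (- (S / L + r))) * \<dots> \<le> ennreal (exp (- (S / L + r))) * ennreal (exp (S / L))"
    using mgf by (rule mult_left_mono) simp
  also have "\<dots> = ennreal (exp (- r))"
    by (simp flip: ennreal_mult exp_add)
  finally show ?thesis
    unfolding Q_def S_def by (simp add: emeasure_eq_measure)
qed

section \<open>Orthonormal families and the signal space\<close>

text \<open>Gaussian elimination, by induction on the number of equations: a pivot unknown
  \<open>p\<close> is solved from the last equation and substituted into the others.\<close>

lemma homogeneous_system_nontrivial_solution:
  fixes A :: "'i \<Rightarrow> nat \<Rightarrow> 'b :: field"
  assumes "finite I" "s < card I"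
  shows "\<exists>c. (\<exists>i\<in>I. c i \<noteq> 0) \<and> (\<forall>j<s. (\<Sum>i\<in>I. c i * A i j) = 0)"
  using assms
proof (induction s arbitrary: I A)
  case 0
  then obtain i where "i \<in> I" by fastforce
  then show ?case by (intro exI[of _ "\<lambda>_. 1"]) auto
next
  case (Suc s)
  show ?case
  proof (cases "\<forall>i\<in>I. A i s = 0")
    case True
    obtain c where "\<exists>i\<in>I. c i \<noteq> 0" "\<forall>j<s. (\<Sum>i\<in>I. c i * A i j) = 0"
      using Suc.IH[of I A] Suc.prems by auto
    with True show ?thesis by (intro exI[of _ c]) (auto simp: less_Suc_eq)
  next
    case False
    then obtain p where p: "p \<in> I" "A p s \<noteq> 0" by auto
    have "finite (I - {p})" "s < card (I - {p})"
      using Suc.prems p by auto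
    from Suc.IH[OF this, of "\<lambda>i j. A i j - A i s / A p s * A p j"]
    obtain c where c: "\<exists>i\<in>I - {p}. c i \<noteq> 0"
      "\<forall>j<s. (\<Sum>i\<in>I - {p}. c i * (A i j - A i s / A p s * A p j)) = 0"
      by auto
    \<comment> \<open>The value at the pivot is the one that makes equation \<open>s\<close>
      hold.\<close>
    define c' where "c' = c(p := - (\<Sum>i\<in>I - {p}. c i * A i s) / A p s)"
    have "(\<Sum>i\<in>I. c' i * A i j) = (\<Sum>i\<in>I - {p}. c i * (A i j - A i s / A p s * A p j))" for j
    proof -
      have "(\<Sum>i\<in>I. c' i * A i j) = c' p * A p j + (\<Sum>i\<in>I - {p}. c' i * A i j)"
        using Suc.prems p by (intro sum.remove) auto
      also have "(\<Sum>i\<in>I - {p}. c' i * A i j) = (\<Sum>i\<in>I - {p}. c i * A i j)"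
        by (intro sum.cong) (auto simp: c'_def)
      also have "c' p * A p j = (\<Sum>i\<in>I - {p}. - (c i * (A i s / A p s * A p j)))"
        by (simp add: c'_def sum_negf sum_distrib_right sum_distrib_left sum_divide_distrib mult_ac)
      finally show ?thesis
        by (simp add: right_diff_distrib flip: sum.distrib)
    qed
    moreover have "(\<Sum>i\<in>I - {p}. c i * (A i s - A i s / A p s * A p s)) = 0"
      using p by simp
    moreover have "\<exists>i\<in>I. c' i \<noteq> 0"
      using c(1) by (auto simp: c'_def)
    ultimately show ?thesis
      using c(2) by (intro exI[of _ c']) (simp add: less_Suc_eq del: times_divide_eq_left)
  qed
qed

lemma of_real_cmod_power2: "(complex_of_real (cmod z))\<^sup>2 = z * cnj z"
  using complex_norm_square[of z] by simp

text \<open>One expansion of the square serves three cases: orthonormal families, characters summed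
  over frequencies and characters summed over times.\<close>

lemma parseval:
  fixes e :: "'k \<Rightarrow> 't \<Rightarrow> complex" and c :: real
  assumes "finite T"
    and orth: "\<And>t t'. t \<in> T \<Longrightarrow> t' \<in> T \<Longrightarrow>
      (\<Sum>k\<in>K. e k t * cnj (e k t')) = (if t = t' then of_real c else 0)"
  shows "(\<Sum>k\<in>K. (cmod (\<Sum>t\<in>T. f t * e k t))\<^sup>2) = c * (\<Sum>t\<in>T. (cmod (f t))\<^sup>2)"
proof -
  have "complex_of_real (\<Sum>k\<in>K. (cmod (\<Sum>t\<in>T. f t * e k t))\<^sup>2)
      = (\<Sum>k\<in>K. \<Sum>t\<in>T. \<Sum>t'\<in>T. f t * cnj (f t') * (e k t * cnj (e k t')))"
    by (simp add: of_real_cmod_power2 sum_product mult_ac)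
  also have "\<dots> = (\<Sum>t\<in>T. \<Sum>t'\<in>T. f t * cnj (f t') * (\<Sum>k\<in>K. e k t * cnj (e k t')))"
    unfolding sum_distrib_left
    by (subst sum.swap, rule sum.cong, simp, subst sum.swap, simp)
  also have "\<dots> = (\<Sum>t\<in>T. \<Sum>t'\<in>T. if t = t' then f t * cnj (f t') * of_real c else 0)"
    by (intro sum.cong) (auto simp: orth)
  also have "\<dots> = (\<Sum>t\<in>T. f t * cnj (f t) * of_real c)"
    using assms(1) by simp
  also have "\<dots> = complex_of_real (c * (\<Sum>t\<in>T. (cmod (f t))\<^sup>2))"
    by (simp add: of_real_cmod_power2 sum_distrib_left mult_ac)
  finally show ?thesis by (simp only: of_real_eq_iff)
qed

text \<open>The \<open>u i\<close> are full two-sided sequences and only the inner product is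
  restricted to \<open>W\<close>; thus they can remain members of \<open>Xset\<close>, which is not
  a space of finite vectors.\<close>

definition orthonormal :: "int set \<Rightarrow> nat \<Rightarrow> (nat \<Rightarrow> int \<Rightarrow> complex) \<Rightarrow> bool" where
  "orthonormal W d u \<longleftrightarrow>
     (\<forall>i<d. \<forall>j<d. (\<Sum>t\<in>W. u i t * cnj (u j t)) = (if i = j then 1 else 0))"

lemma orthonormal_pythagoras:
  assumes "orthonormal W d u"
  shows "(\<Sum>t\<in>W. (cmod (\<Sum>i<d. g i * u i t))\<^sup>2) = (\<Sum>i<d. (cmod (g i))\<^sup>2)"
  using parseval[of "{..<d}" "\<lambda>t i. u i t" W 1 g] assms by (auto simp: orthonormal_def)

lemma orthonormal_coeff:
  assumes "orthonormal W d u" "j < d"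
  shows "(\<Sum>t\<in>W. (\<Sum>i<d. g i * u i t) * cnj (u j t)) = g j"
proof -
  have "(\<Sum>t\<in>W. (\<Sum>i<d. g i * u i t) * cnj (u j t))
      = (\<Sum>i<d. g i * (\<Sum>t\<in>W. u i t * cnj (u j t)))"
    unfolding sum_distrib_right sum_distrib_left by (subst sum.swap) (simp add: mult_ac)
  also have "\<dots> = (\<Sum>i<d. if i = j then g i else 0)"
    using assms by (intro sum.cong) (auto simp: orthonormal_def)
  finally show ?thesis using assms(2) by simp
qed

lemma orthonormal_bessel:
  assumes on: "orthonormal W d u"
  shows "(\<Sum>i<d. (cmod (\<Sum>t\<in>W. f t * cnj (u i t)))\<^sup>2) \<le> (\<Sum>t\<in>W. (cmod (f t))\<^sup>2)"
proof -
  define c where "c i = (\<Sum>t\<in>W. f t * cnj (u i t))" for i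
  define p where "p t = (\<Sum>i<d. c i * u i t)" for t
  have pp: "(\<Sum>t\<in>W. (cmod (p t))\<^sup>2) = (\<Sum>i<d. (cmod (c i))\<^sup>2)"
    unfolding p_def by (rule orthonormal_pythagoras[OF on])
  have fp: "(\<Sum>t\<in>W. f t * cnj (p t)) = complex_of_real (\<Sum>i<d. (cmod (c i))\<^sup>2)"
  proof -
    have "(\<Sum>t\<in>W. f t * cnj (p t)) = (\<Sum>i<d. cnj (c i) * (\<Sum>t\<in>W. f t * cnj (u i t)))"
      unfolding p_def cnj_sum sum_distrib_left by (subst sum.swap) (simp add: mult_ac)
    then show ?thesis by (simp add: of_real_cmod_power2 c_def[symmetric] mult_ac)
  qed
  have sq: "(cmod (f t - p t))\<^sup>2 = (cmod (f t))\<^sup>2 + (cmod (p t))\<^sup>2 - 2 * Re (f t * cnj (p t))" for t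
    unfolding cmod_power2 by (simp add: power2_eq_square algebra_simps)
  have "0 \<le> (\<Sum>t\<in>W. (cmod (f t - p t))\<^sup>2)" by (intro sum_nonneg) auto
  also have "\<dots> = (\<Sum>t\<in>W. (cmod (f t))\<^sup>2) + (\<Sum>t\<in>W. (cmod (p t))\<^sup>2) - 2 * Re (\<Sum>t\<in>W. f t * cnj (p t))"
    unfolding sq Re_sum sum_distrib_left sum.distrib sum_subtractf ..
  finally show ?thesis unfolding fp pp c_def by simp
qed

section \<open>The signal space as the solutions of a linear recursion\<close>

lemma coeff_0_fpoly: "coeff (fpoly s w) 0 = 1"
proof -
  have "poly (fpoly s w) 0 = 1" unfolding fpoly_def poly_prod by simp
  then show ?thesis by (simp only: poly_0_coeff_0)
qed

lemma degree_fpoly: "degree (fpoly s w) \<le> s"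
proof -
  have "degree (fpoly s w) \<le> (\<Sum>k<s. degree [:1, - w k:])"
    unfolding fpoly_def using degree_prod_sum_le[of "{..<s}" "\<lambda>k. [:1, - w k:]"] by (simp add: o_def)
  also have "\<dots> \<le> (\<Sum>k<s. 1)" by (rule sum_mono) simp
  finally show ?thesis by simp
qed

lemma Xset_iff: "x \<in> Xset s w \<longleftrightarrow>
    (\<forall>t. (\<Sum>j\<le>degree (fpoly s w). coeff (fpoly s w) j * x (t - int j)) = 0)"
  by (auto simp: Xset_def poly_shift_def fun_eq_iff)

lemma Xset_shift: "x \<in> Xset s w \<Longrightarrow> (\<lambda>t. x (t - k)) \<in> Xset s w"
proof -
  assume "x \<in> Xset s w"
  moreover have eq: "t - int j - k = t - k - int j" for t j by simp
  ultimately show ?thesis unfolding Xset_iff eq by blast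
qed

lemma Xset_sum:
  assumes "\<And>i. i \<in> I \<Longrightarrow> u i \<in> Xset s w"
  shows "(\<lambda>t. \<Sum>i\<in>I. c i * u i t) \<in> Xset s w"
  unfolding Xset_iff
proof
  fix t
  let ?p = "fpoly s w"
  have "(\<Sum>j\<le>degree ?p. coeff ?p j * (\<Sum>i\<in>I. c i * u i (t - int j)))
      = (\<Sum>i\<in>I. c i * (\<Sum>j\<le>degree ?p. coeff ?p j * u i (t - int j)))"
    unfolding sum_distrib_left by (subst sum.swap) (simp add: mult_ac)
  also have "\<dots> = 0" using assms by (intro sum.neutral) (auto simp: Xset_iff)
  finally show "(\<Sum>j\<le>degree ?p. coeff ?p j * (\<Sum>i\<in>I. c i * u i (t - int j))) = 0" .
qed

lemma Xset_diff:
  assumes "x \<in> Xset s w" "y \<in> Xset s w"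
  shows "(\<lambda>t. x t - y t) \<in> Xset s w"
  using assms unfolding Xset_iff right_diff_distrib sum_subtractf by simp

lemma Xset_scale: "x \<in> Xset s w \<Longrightarrow> (\<lambda>t. c * x t) \<in> Xset s w"
  unfolding Xset_iff mult.left_commute[of _ c] sum_distrib_left[symmetric] by simp

text \<open>Since \<open>fpoly\<close> has constant term 1 and degree at most \<open>s\<close>, the
  difference equation expresses each value by the \<open>s\<close> preceding ones. Vanishing or
  repeated \<open>w k\<close> do no harm in this direction.\<close>

lemma Xset_eq_0_forward:
  assumes x: "x \<in> Xset s w" and init: "\<And>j. j < s \<Longrightarrow> x (a + int j) = 0"
  shows "x (a + int k) = 0"
proof (induction k rule: less_induct)
  case (less k)
  show ?case
  proof (cases "k < s")
    case False
    let ?p = "fpoly s w"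
    have "0 = (\<Sum>j\<le>degree ?p. coeff ?p j * x (a + int k - int j))"
      using x by (simp add: Xset_iff)
    also have "\<dots> = (\<Sum>j\<in>{0}. coeff ?p j * x (a + int k - int j))"
    proof (rule sum.mono_neutral_right)
      show "\<forall>i\<in>{..degree ?p} - {0}. coeff ?p i * x (a + int k - int i) = 0"
      proof
        fix i assume i: "i \<in> {..degree ?p} - {0}"
        then have "i \<le> k" "0 < i" using degree_fpoly[of s w] False by auto
        then have "x (a + int (k - i)) = 0" by (intro less.IH) auto
        then show "coeff ?p i * x (a + int k - int i) = 0"
          using \<open>i \<le> k\<close> by (simp add: of_nat_diff algebra_simps)
      qed
    qed auto
    finally show ?thesis by (simp add: coeff_0_fpoly)
  qed (use init in auto)
qed

text \<open>More than \<open>s\<close> sequences would have a nontrivial combination vanishing at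
  the \<open>s\<close> points from \<open>a\<close> on. By the recursion it vanishes on the whole
  window, and orthonormality kills its coefficients.\<close>

lemma orthonormal_Xset_le:
  assumes on: "orthonormal {a..b} d u" and X: "\<And>i. i < d \<Longrightarrow> u i \<in> Xset s w"
  shows "d \<le> s"
proof (rule ccontr)
  assume "\<not> d \<le> s"
  then obtain c where c: "\<exists>i\<in>{..<d}. c i \<noteq> 0" "\<forall>j<s. (\<Sum>i<d. c i * u i (a + int j)) = 0"
    using homogeneous_system_nontrivial_solution[of "{..<d}" s "\<lambda>i j. u i (a + int j)"] by auto
  have mem: "(\<lambda>t. \<Sum>i<d. c i * u i t) \<in> Xset s w" using X by (intro Xset_sum) auto
  have "(\<Sum>i<d. c i * u i t) = 0" if "t \<in> {a..b}" for t
    using Xset_eq_0_forward[OF mem, of a "nat (t - a)"] c(2) that by auto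
  then have "c j = 0" if "j < d" for j
    using orthonormal_coeff[OF on that, of c] by simp
  with c(1) show False by auto
qed

text \<open>The size of orthonormal families is bounded by \<open>s\<close>, so a largest one
  exists. If the projection of some signal missed it at a point of the window, the normalized
  residual, again a signal, would enlarge the family.\<close>

lemma Xset_orthonormal_basis:
  obtains d u where "d \<le> s" "orthonormal {a..b} d u" "\<And>i. i < d \<Longrightarrow> u i \<in> Xset s w"
    "\<And>x t. x \<in> Xset s w \<Longrightarrow> t \<in> {a..b} \<Longrightarrow>
       x t = (\<Sum>i<d. (\<Sum>r\<in>{a..b}. x r * cnj (u i r)) * u i t)"
proof -
  define P where "P d \<longleftrightarrow> (\<exists>u. orthonormal {a..b} d u \<and> (\<forall>i<d. u i \<in> Xset s w))" for d
  have P0: "P 0" by (simp add: P_def orthonormal_def)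
  have bound: "d \<le> s" if "P d" for d
    using that orthonormal_Xset_le unfolding P_def by blast
  define d where "d = Greatest P"
  have Pd: "P d" unfolding d_def using P0 bound by (rule GreatestI_nat)
  have max: "\<not> P (Suc d)"
    using Greatest_le_nat[of P "Suc d" s] bound unfolding d_def by auto
  from Pd obtain u where on: "orthonormal {a..b} d u" and u: "\<And>i. i < d \<Longrightarrow> u i \<in> Xset s w"
    by (auto simp: P_def)
  have "x t = (\<Sum>i<d. (\<Sum>r\<in>{a..b}. x r * cnj (u i r)) * u i t)"
    if x: "x \<in> Xset s w" and t: "t \<in> {a..b}" for x t
  proof (rule ccontr)
    define p where "p r = (\<Sum>i<d. (\<Sum>r\<in>{a..b}. x r * cnj (u i r)) * u i r)" for r
    define y where "y r = x r - p r" for r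
    assume "x t \<noteq> (\<Sum>i<d. (\<Sum>r\<in>{a..b}. x r * cnj (u i r)) * u i t)"
    then have "y t \<noteq> 0" by (simp add: y_def p_def)
    define q where "q = (\<Sum>r\<in>{a..b}. (cmod (y r))\<^sup>2)"
    have "(cmod (y t))\<^sup>2 \<le> q" unfolding q_def using t by (intro member_le_sum) auto
    then have q: "q > 0" using \<open>y t \<noteq> 0\<close> by (smt (verit) zero_less_norm_iff zero_less_power)
    have yX: "y \<in> Xset s w"
      unfolding y_def p_def by (intro Xset_diff x Xset_sum) (use u in auto)
    have yu: "(\<Sum>r\<in>{a..b}. y r * cnj (u j r)) = 0" if "j < d" for j
      using orthonormal_coeff[OF on that, of "\<lambda>i. \<Sum>r\<in>{a..b}. x r * cnj (u i r)"]
      by (simp add: y_def p_def left_diff_distrib sum_subtractf)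
    then have uy: "(\<Sum>r\<in>{a..b}. u j r * cnj (y r)) = 0" if "j < d" for j
      using arg_cong[OF yu[OF that], of cnj] by (simp add: mult.commute)
    define v where "v = u(d := \<lambda>r. complex_of_real (1 / sqrt q) * y r)"
    have "(\<Sum>r\<in>{a..b}. v i r * cnj (v j r)) = (if i = j then 1 else 0)" if ij: "i < Suc d" "j < Suc d" for i j
    proof -
      consider "i < d" "j < d" | "i < d" "j = d" | "i = d" "j < d" | "i = d" "j = d"
        using ij by linarith
      then show ?thesis
      proof cases
        case 1
        then show ?thesis using on by (simp add: v_def orthonormal_def)
      next
        case 2
        then show ?thesis using uy[of i]
          by (simp add: v_def mult.left_commute mult.assoc divide_simps flip: sum_divide_distrib)
      next
        case 3
        then show ?thesis using yu[of j]
          by (simp add: v_def mult.assoc divide_simps flip: sum_divide_distrib)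
      next
        case 4
        have "(\<Sum>r\<in>{a..b}. v i r * cnj (v j r)) = complex_of_real (1 / q) * (\<Sum>r\<in>{a..b}. y r * cnj (y r))"
          unfolding sum_distrib_left
        proof (rule sum.cong)
          fix r
          have "complex_of_real (sqrt q) * complex_of_real (sqrt q) = of_real q"
            using q by (simp flip: of_real_mult)
          then show "v i r * cnj (v j r) = complex_of_real (1 / q) * (y r * cnj (y r))"
            using 4 by (simp add: v_def mult_ac)
        qed simp
        also have "(\<Sum>r\<in>{a..b}. y r * cnj (y r)) = complex_of_real q"
          by (simp add: q_def of_real_cmod_power2)
        finally show ?thesis using 4 q by simp
      qed
    qed
    moreover have "v i \<in> Xset s w" if "i < Suc d" for i
    proof (cases "i = d")
      case True
      then have "v i = (\<lambda>r. complex_of_real (1 / sqrt q) * y r)" by (simp only: v_def fun_upd_same)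
      then show ?thesis using Xset_scale[OF yX] by (simp only:)
    qed (use that u in \<open>auto simp: v_def\<close>)
    ultimately have "P (Suc d)" unfolding P_def orthonormal_def by blast
    with max show False by simp
  qed
  with that[OF bound[OF Pd] on u] show thesis by blast
qed

section \<open>Characters and the Dirichlet kernel\<close>

text \<open>Here and in the lemmas on \<open>chi\<close> alone, \<open>n\<close> is the modulus. It
  is instantiated by \<open>2 * n + 1\<close> (the DFT grid) and by \<open>2 * (2 * n + 1)\<close>
  (the doubled grid), with \<open>n\<close> the half-width of the window.\<close>

definition chi :: "nat \<Rightarrow> int \<Rightarrow> complex" where
  "chi n l = cis (2 * pi * of_int l / of_nat n)"

lemma chi_add: "chi n (a + b) = chi n a * chi n b"
  by (simp add: chi_def cis_mult add_divide_distrib distrib_left)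

lemma chi_0 [simp]: "chi n 0 = 1"
  by (simp add: chi_def)

lemma norm_chi [simp]: "cmod (chi n l) = 1"
  by (simp add: chi_def)

lemma cnj_chi: "cnj (chi n l) = chi n (- l)"
  by (simp add: chi_def cis_cnj)

lemma chi_eq_1_iff:
  assumes "n > 0"
  shows "chi n l = 1 \<longleftrightarrow> int n dvd l"
proof
  assume "chi n l = 1"
  then obtain k :: int where "2 * pi * of_int l / of_nat n = of_int (2 * k) * pi"
    unfolding chi_def cis_conv_exp exp_eq_1 by auto
  then have "real_of_int l = real_of_int (k * int n)"
    using assms by (simp add: field_simps)
  then show "int n dvd l" by (simp only: of_int_eq_iff dvd_triv_right)
next
  assume "int n dvd l"
  then obtain k where "l = int n * k" by auto
  then have "2 * pi * of_int l / of_nat n = 2 * pi * of_int k"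
    using assms by simp
  then show "chi n l = 1"
    by (simp only: chi_def cis_multiple_2pi[OF Ints_of_int])
qed

lemma chi_power: "chi n l ^ k = chi n (int k * l)"
  by (induction k) (simp_all add: chi_add distrib_right)

lemma chi_cong:
  assumes "n > 0" "int n dvd a - b"
  shows "chi n a = chi n b"
  using chi_add[of n "a - b" b] chi_eq_1_iff[OF assms(1)] assms(2) by simp

lemma chi_double: "chi (2 * n) (2 * l) = chi n l"
  by (simp add: chi_def mult.assoc)

lemma sum_chi:
  assumes "n > 0"
  shows "(\<Sum>k<n. chi n (int k * l)) = (if int n dvd l then of_nat n else 0)"
proof (cases "int n dvd l")
  case True
  then show ?thesis
    using assms by (simp add: chi_eq_1_iff[THEN iffD2])
next
  case False
  then have "chi n l \<noteq> 1" using assms by (simp add: chi_eq_1_iff)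
  moreover have "chi n l ^ n = 1"
    using assms by (simp add: chi_power chi_eq_1_iff)
  ultimately show ?thesis
    using False geometric_sum[of "chi n l" n] by (simp add: chi_power)
qed

lemma sum_int_window:
  fixes f :: "int \<Rightarrow> 'b :: comm_monoid_add"
  shows "(\<Sum>t\<in>{a..<a + int n}. f t) = (\<Sum>k<n. f (a + int k))"
  by (rule sum.reindex_bij_witness[of _ "\<lambda>k. a + int k" "\<lambda>t. nat (t - a)"]) auto

lemma symmetric_window: "{- int n..int n} = {- int n..<- int n + int (2 * n + 1)}"
  by auto

lemma sum_chi_window:
  assumes "n > 0"
  shows "(\<Sum>t\<in>{a..<a + int n}. chi n (t * l)) = (if int n dvd l then of_nat n else 0)"
proof -
  have "(\<Sum>t\<in>{a..<a + int n}. chi n (t * l)) = chi n (a * l) * (\<Sum>k<n. chi n (int k * l))"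
    unfolding sum_int_window by (simp add: distrib_right chi_add sum_distrib_left)
  then show ?thesis
    using assms by (simp add: sum_chi chi_eq_1_iff[THEN iffD2])
qed

text \<open>Turns the divisibility condition in character orthogonality into equality of indices;
  every claim that there is no wrap-around rests on it.\<close>

lemma dvd_diff_window:
  fixes t t' :: int
  assumes "t \<in> {a..<a + int n}" "t' \<in> {a..<a + int n}"
  shows "int n dvd t - t' \<longleftrightarrow> t = t'"
  using assms zdvd_not_zless[of "t - t'" "int n"] zdvd_not_zless[of "t' - t" "int n"]
  by (smt (verit) atLeastLessThan_iff dvd_0_right dvd_diff_commute)

lemma parseval_chi_window:
  assumes "n > 0" "T \<subseteq> {a..<a + int n}"
  shows "(\<Sum>k<n. (cmod (\<Sum>t\<in>T. f t * chi n (- (int k * t))))\<^sup>2) = real n * (\<Sum>t\<in>T. (cmod (f t))\<^sup>2)"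
proof (rule parseval)
  show "finite T" using assms(2) finite_subset by blast
  fix t t' assume "t \<in> T" "t' \<in> T"
  then have "int n dvd t' - t \<longleftrightarrow> t = t'"
    using dvd_diff_window[of t' a n t] assms(2) by (metis subsetD)
  moreover have "(\<Sum>k<n. chi n (- (int k * t)) * cnj (chi n (- (int k * t'))))
      = (\<Sum>k<n. chi n (int k * (t' - t)))"
    by (simp add: cnj_chi right_diff_distrib flip: chi_add)
  ultimately show "(\<Sum>k<n. chi n (- (int k * t)) * cnj (chi n (- (int k * t'))))
      = (if t = t' then complex_of_real (real n) else 0)"
    using assms(1) by (simp add: sum_chi)
qed

text \<open>Equality holds on a full period and the points outside \<open>T\<close> are dropped.
  This is the contractivity that the Gaussian bounds ask for.\<close>

lemma parseval_chi_grid: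
  assumes "n > 0" "T \<subseteq> {a..<a + int n}"
  shows "(\<Sum>t\<in>T. (cmod (\<Sum>k<n. g k * chi n (int k * t)))\<^sup>2) \<le> real n * (\<Sum>k<n. (cmod (g k))\<^sup>2)"
proof -
  have "(\<Sum>t\<in>T. (cmod (\<Sum>k<n. g k * chi n (int k * t)))\<^sup>2)
      \<le> (\<Sum>t\<in>{a..<a + int n}. (cmod (\<Sum>k<n. g k * chi n (int k * t)))\<^sup>2)"
    using assms(2) by (intro sum_mono2) auto
  also have "\<dots> = real n * (\<Sum>k<n. (cmod (g k))\<^sup>2)"
  proof (rule parseval)
    fix k k' assume "k \<in> {..<n}" "k' \<in> {..<n}"
    then have "int n dvd int k - int k' \<longleftrightarrow> k = k'"
      using dvd_diff_window[of "int k" 0 n "int k'"] by auto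
    moreover have "(\<Sum>t\<in>{a..<a + int n}. chi n (int k * t) * cnj (chi n (int k' * t)))
        = (\<Sum>t\<in>{a..<a + int n}. chi n (t * (int k - int k')))"
      by (simp add: cnj_chi right_diff_distrib mult.commute flip: chi_add)
    ultimately show "(\<Sum>t\<in>{a..<a + int n}. chi n (int k * t) * cnj (chi n (int k' * t)))
        = (if k = k' then complex_of_real (real n) else 0)"
      using assms(1) by (simp add: sum_chi_window)
  qed simp
  finally show ?thesis .
qed

section \<open>Decay of the Dirichlet kernel at half-steps\<close>

lemma sin_ge_chord:
  assumes "0 \<le> y" "y \<le> pi / 2"
  shows "2 * y / pi \<le> sin y"
proof -
  \<comment> \<open>Jordan's inequality: \<open>sin\<close> is concave on this interval and so lies
    above its chord.\<close>
  have "convex_on {0..pi / 2} (\<lambda>x. - sin x)"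
  proof (rule f''_ge0_imp_convex)
    show "((\<lambda>x. - sin x) has_real_derivative - cos x) (at x)" for x
      by (auto intro!: derivative_eq_intros)
    show "((\<lambda>x. - cos x) has_real_derivative sin x) (at x)" for x
      by (auto intro!: derivative_eq_intros)
    show "0 \<le> sin x" if "x \<in> {0..pi / 2}" for x
      using that by (intro sin_ge_zero) auto
  qed auto
  from convex_onD[OF this, of "2 * y / pi" 0 "pi / 2"] assms show ?thesis
    by (simp add: field_simps)
qed

lemma cmod_cis_minus_1: "cmod (cis x - 1) = 2 * \<bar>sin (x / 2)\<bar>"
proof -
  have "(cmod (cis x - 1))\<^sup>2 = (cos x - 1)\<^sup>2 + (sin x)\<^sup>2"
    by (simp add: cmod_power2)
  also have "\<dots> = 2 - 2 * cos x"
    using sin_cos_squared_add[of x] by (simp add: power2_eq_square algebra_simps)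
  also have "cos x = 1 - 2 * (sin (x / 2))\<^sup>2"
    using cos_double_sin[of "x / 2"] by simp
  finally have "(cmod (cis x - 1))\<^sup>2 = (2 * \<bar>sin (x / 2)\<bar>)\<^sup>2"
    by (simp add: power_mult_distrib)
  then show ?thesis
    by (metis abs_ge_zero mult_nonneg_nonneg norm_ge_zero power2_eq_iff_nonneg zero_le_numeral)
qed

text \<open>The normalized Dirichlet kernel at the angle \<open>pi * l / (2 * n + 1)\<close>: \<open>l\<close> counts half-steps of the grid of \<^const>\<open>dft\<close>.\<close>
definition dirichlet :: "nat \<Rightarrow> int \<Rightarrow> real" where
  "dirichlet n l = cmod (\<Sum>t\<in>{- int n..int n}. chi (2 * (2 * n + 1)) (t * l)) / real (2 * n + 1)"

lemma dirichlet_nonneg: "0 \<le> dirichlet n l"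
  by (simp add: dirichlet_def)

lemma dirichlet_le_1: "dirichlet n l \<le> 1"
proof -
  have "cmod (\<Sum>t\<in>{- int n..int n}. chi (2 * (2 * n + 1)) (t * l))
      \<le> (\<Sum>t\<in>{- int n..int n}. cmod (chi (2 * (2 * n + 1)) (t * l)))"
    by (rule norm_sum)
  then show ?thesis by (simp add: dirichlet_def)
qed

lemma dirichlet_cong:
  assumes "2 * (2 * int n + 1) dvd l - l'"
  shows "dirichlet n l = dirichlet n l'"
proof -
  have "chi (2 * (2 * n + 1)) (t * l) = chi (2 * (2 * n + 1)) (t * l')" for t
  proof (rule chi_cong)
    show "int (2 * (2 * n + 1)) dvd t * l - t * l'"
      using dvd_mult[OF assms, of t] by (simp add: right_diff_distrib algebra_simps)
  qed simp
  then show ?thesis by (simp add: dirichlet_def)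
qed

text \<open>An even number of half-steps is a point of the DFT grid, where the full character sum
  vanishes unless the character is trivial.\<close>

lemma dirichlet_even:
  assumes "even l" "\<not> 2 * (2 * int n + 1) dvd l"
  shows "dirichlet n l = 0"
proof -
  from assms(1) obtain q where q: "l = 2 * q" by auto
  have nd: "\<not> int (2 * n + 1) dvd q"
    using assms(2) mult_dvd_mono[of 2 2 "2 * int n + 1" q] unfolding q by (auto simp: add.commute)
  have eq: "chi (2 * (2 * n + 1)) (t * l) = chi (2 * n + 1) (t * q)" for t
    unfolding q mult.left_commute[of t 2 q] by (rule chi_double)
  have "(\<Sum>t\<in>{- int n..int n}. chi (2 * (2 * n + 1)) (t * l))
      = (if int (2 * n + 1) dvd q then of_nat (2 * n + 1) else 0)"
    unfolding eq symmetric_window by (rule sum_chi_window) simp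
  then show ?thesis
    unfolding dirichlet_def by (simp only: nd if_False norm_zero div_0)
qed

text \<open>The geometric sum has modulus at most 2 divided by the distance of
  \<open>chi (2 * N) l\<close> from 1. That distance is twice a sine whose angle stays below
  \<open>pi / 2\<close> exactly because \<open>l\<close> is at most \<open>N\<close> in modulus, and
  Jordan's inequality makes it linear in \<open>l\<close>.\<close>

lemma dirichlet_odd:
  assumes "odd l" "\<bar>l\<bar> \<le> 2 * int n + 1"
  shows "dirichlet n l \<le> 1 / \<bar>of_int l\<bar>"
proof -
  define N where "N = 2 * n + 1"
  have N: "N > 0" by (simp add: N_def)
  have l0: "l \<noteq> 0" using assms(1) by auto
  let ?z = "chi (2 * N) l"
  have "(\<Sum>t\<in>{- int n..int n}. chi (2 * N) (t * l)) = chi (2 * N) (- int n * l) * (\<Sum>k<N. ?z ^ k)"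
    unfolding symmetric_window N_def[symmetric] sum_int_window
    by (simp only: distrib_right chi_add sum_distrib_left chi_power)
  then have eq: "cmod (\<Sum>t\<in>{- int n..int n}. chi (2 * N) (t * l)) = cmod (\<Sum>k<N. ?z ^ k)"
    by (simp add: norm_mult)
  have "cmod (?z - 1) * cmod (\<Sum>k<N. ?z ^ k) = cmod (?z ^ N - 1)"
    by (simp add: power_diff_1_eq norm_mult)
  also have "\<dots> \<le> 2"
    using norm_triangle_ineq4[of "?z ^ N" 1] by (simp add: chi_power)
  finally have up: "cmod (?z - 1) * cmod (\<Sum>k<N. ?z ^ k) \<le> 2" .
  define y where "y = pi * \<bar>of_int l\<bar> / (2 * of_nat N)"
  have lN: "\<bar>real_of_int l\<bar> \<le> real N"
    using assms(2) unfolding N_def by linarith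
  have y: "0 \<le> y" "y \<le> pi / 2"
    using N lN by (auto simp: y_def field_simps)
  have "cmod (?z - 1) = 2 * \<bar>sin (pi * of_int l / (2 * of_nat N))\<bar>"
    unfolding chi_def cmod_cis_minus_1 by (simp add: mult.commute)
  also have "\<bar>sin (pi * of_int l / (2 * of_nat N))\<bar> = \<bar>sin y\<bar>"
    by (cases "l \<ge> 0") (auto simp: y_def)
  also have "2 * \<bar>sin y\<bar> \<ge> 2 * (2 * y / pi)"
    using sin_ge_chord[OF y] by simp
  also have "2 * (2 * y / pi) = 2 * \<bar>of_int l\<bar> / of_nat N"
    using N by (simp add: y_def)
  finally have low: "2 * \<bar>of_int l\<bar> / of_nat N \<le> cmod (?z - 1)" .
  have "2 * \<bar>of_int l\<bar> / of_nat N * cmod (\<Sum>k<N. ?z ^ k) \<le> 2"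
    using mult_right_mono[OF low norm_ge_zero[of "\<Sum>k<N. ?z ^ k"]] up by linarith
  then have "cmod (\<Sum>k<N. ?z ^ k) / of_nat N \<le> 1 / \<bar>of_int l\<bar>"
    using l0 N by (simp add: field_simps)
  then show ?thesis
    unfolding dirichlet_def N_def[symmetric] eq .
qed

text \<open>The representative of \<open>l\<close> of least absolute value modulo \<open>2 * (2 * n + 1)\<close>.\<close>
definition symm_mod :: "nat \<Rightarrow> int \<Rightarrow> int" where
  "symm_mod n l = (l + (2 * int n + 1)) mod (2 * (2 * int n + 1)) - (2 * int n + 1)"

lemma symm_mod_bound: "\<bar>symm_mod n l\<bar> \<le> 2 * int n + 1"
proof -
  have p: "0 < 2 * (2 * int n + 1)" by simp
  have aux: "0 \<le> x \<Longrightarrow> x < 2 * c \<Longrightarrow> \<bar>x - c\<bar> \<le> c" for x c :: int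
    by linarith
  show ?thesis
    unfolding symm_mod_def by (rule aux[OF pos_mod_sign[OF p] pos_mod_bound[OF p]])
qed

lemma symm_mod_cong: "2 * (2 * int n + 1) dvd l - symm_mod n l"
proof -
  have "l - symm_mod n l = (l + (2 * int n + 1)) - (l + (2 * int n + 1)) mod (2 * (2 * int n + 1))"
    by (simp add: symm_mod_def)
  then show ?thesis by (simp only: minus_mod_eq_mult_div dvd_triv_left)
qed

lemma symm_mod_eqD:
  assumes "symm_mod n l = symm_mod n l'"
  shows "2 * (2 * int n + 1) dvd l - l'"
  using dvd_diff[OF symm_mod_cong[of n l] symm_mod_cong[of n l']] assms by simp

lemma odd_symm_mod: "odd (symm_mod n l) \<longleftrightarrow> odd l"
proof -
  have "even (l - symm_mod n l)" using symm_mod_cong[of n l] dvd_mult_left by blast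
  then show ?thesis by simp
qed

section \<open>Sums of Dirichlet kernels over frequencies\<close>

definition odd_harmonic :: "nat \<Rightarrow> real" where
  "odd_harmonic K = (\<Sum>i<K. 1 / (2 * real i + 1))"

text \<open>Each new term is below half of \<open>1 / (k + 1)\<close>, which is at most half the
  increment of the logarithm. The constant 3/2 dominates the first two terms, 1 + 1/3.\<close>

lemma odd_harmonic_Suc_le: "k \<ge> 1 \<Longrightarrow> odd_harmonic (Suc k) \<le> 3 / 2 + ln k / 2"
proof (induction k rule: nat_induct_at_least)
  case base
  then show ?case by (simp add: odd_harmonic_def)
next
  case (Suc k)
  have "ln (real k / real (Suc k)) \<le> real k / real (Suc k) - 1"
    using Suc by (intro ln_le_minus_one) auto
  then have "1 / real (Suc k) \<le> ln (Suc k) - ln k"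
    using Suc by (simp add: ln_div field_simps)
  then have "1 / real (Suc k) / 2 \<le> (ln (Suc k) - ln k) / 2"
    by (rule divide_right_mono) simp
  moreover have "1 / (2 * real (Suc k) + 1) \<le> 1 / real (Suc k) / 2"
    unfolding divide_divide_eq_left by (intro divide_left_mono) auto
  ultimately have "1 / (2 * real (Suc k) + 1) \<le> (ln (Suc k) - ln k) / 2"
    by (rule order.trans[rotated])
  then have "odd_harmonic (Suc k) + 1 / (2 * real (Suc k) + 1) \<le> (3 / 2 + ln k / 2) + (ln (Suc k) - ln k) / 2"
    using Suc.IH by (rule add_mono[rotated])
  also have "\<dots> = 3 / 2 + ln (Suc k) / 2"
    by (simp add: diff_divide_distrib)
  finally show ?case
    by (simp add: odd_harmonic_def)
qed

lemma odd_harmonic_le: "k \<ge> 1 \<Longrightarrow> odd_harmonic k \<le> 3 / 2 + ln k / 2"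
  using odd_harmonic_Suc_le[of k] by (simp add: odd_harmonic_def) (smt (verit) divide_nonneg_nonneg of_nat_0_le_iff)

text \<open>Either the largest index in \<open>A\<close> is at least \<open>K\<close>, so that its
  term is at most \<open>f K\<close> and can be split off, or \<open>A\<close> lies within the first
  \<open>K + 1\<close> indices.\<close>

lemma sum_antimono_le_initial:
  fixes f :: "nat \<Rightarrow> real"
  assumes "finite A" "card A \<le> K" "antimono f" "\<And>i. 0 \<le> f i"
  shows "sum f A \<le> sum f {..<K}"
  using assms(1,2)
proof (induction K arbitrary: A)
  case (Suc K)
  show ?case
  proof (cases "A = {}")
    case False
    define a where "a = Max A"
    have a: "a \<in> A" using Suc False by (simp add: a_def)
    have Au: "card (A - {a}) \<le> K" using a Suc by simp
    show ?thesis
    proof (cases "K \<le> a")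
      case True
      have "sum f A = f a + sum f (A - {a})" using a Suc by (simp add: sum.remove)
      also have "\<dots> \<le> f K + sum f {..<K}"
        using Suc.IH[of "A - {a}", OF _ Au] Suc.prems(1) antimonoD[OF assms(3) True]
        by (intro add_mono) simp_all
      finally show ?thesis by simp
    next
      case False
      then have "A \<subseteq> {..<Suc K}"
        using Max_ge[OF Suc.prems(1)] unfolding a_def by fastforce
      then show ?thesis using assms(4) by (intro sum_mono2) auto
    qed
  qed (use assms(4) in \<open>simp add: sum_nonneg\<close>)
qed (use assms in auto)

text \<open>The factor 2 accounts for the two signs: on either half the absolute value is injective,
  and the moduli are distinct odd numbers, indexed by \<open>?g\<close>.\<close>

lemma sum_inverse_odd_le:
  fixes A :: "int set"
  assumes "finite A" "card A \<le> K" "\<And>r. r \<in> A \<Longrightarrow> odd r"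
  shows "(\<Sum>r\<in>A. 1 / \<bar>real_of_int r\<bar>) \<le> 2 * odd_harmonic K"
proof -
  let ?f = "\<lambda>i::nat. 1 / (2 * real i + 1)"
  let ?g = "\<lambda>r::int. nat ((\<bar>r\<bar> - 1) div 2)"
  have anti: "antimono ?f"
    by (rule antimonoI) (auto intro!: divide_left_mono)
  have half: "(\<Sum>r\<in>B. 1 / \<bar>real_of_int r\<bar>) \<le> odd_harmonic K"
    if B: "B \<subseteq> A" and inj: "inj_on (\<lambda>r. \<bar>r\<bar>) B" for B
  proof -
    have g: "\<bar>r\<bar> = 2 * int (?g r) + 1" if "r \<in> B" for r
    proof -
      have "odd \<bar>r\<bar>" using that B assms(3) by auto
      then obtain q where "\<bar>r\<bar> = 2 * q + 1" by (rule oddE)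
      then show ?thesis by auto
    qed
    have inj_g: "inj_on ?g B"
      using g inj unfolding inj_on_def by metis
    have "(\<Sum>r\<in>B. 1 / \<bar>real_of_int r\<bar>) = (\<Sum>r\<in>B. ?f (?g r))"
    proof (rule sum.cong)
      fix r assume "r \<in> B"
      then have "real_of_int \<bar>r\<bar> = 2 * real (?g r) + 1" using g[of r] by linarith
      then show "1 / \<bar>real_of_int r\<bar> = ?f (?g r)" by simp
    qed simp
    also have "\<dots> = sum ?f (?g ` B)"
      using inj_g by (simp add: sum.reindex)
    also have "\<dots> \<le> sum ?f {..<K}"
    proof (rule sum_antimono_le_initial[OF _ _ anti])
      have "finite B" using B assms(1) finite_subset by blast
      then show "finite (?g ` B)" by simp
      show "card (?g ` B) \<le> K"
        using inj_g card_mono[OF assms(1) B] assms(2) by (simp add: card_image)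
    qed simp
    finally show ?thesis by (simp add: odd_harmonic_def)
  qed
  have "(\<Sum>r\<in>A. 1 / \<bar>real_of_int r\<bar>)
      = (\<Sum>r\<in>A \<inter> {r. r \<ge> 0}. 1 / \<bar>real_of_int r\<bar>) + (\<Sum>r\<in>A \<inter> - {r. r \<ge> 0}. 1 / \<bar>real_of_int r\<bar>)"
    using assms(1) by (subst sum.union_disjoint[symmetric]) (auto intro!: sum.cong)
  also have "\<dots> \<le> odd_harmonic K + odd_harmonic K"
    by (intro add_mono half) (auto simp: inj_on_def)
  finally show ?thesis by simp
qed

text \<open>Distinct residues have distinct representatives of least modulus, so the odd ones are
  summed by reciprocals. Among the even ones only the zero residue contributes, and it occurs at
  most once.\<close>

lemma dirichlet_sum_le:
  assumes fin: "finite S" and card: "card S \<le> K"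
    and inj: "inj_on (\<lambda>j. symm_mod n (g j)) S"
  shows "(\<Sum>j\<in>{j\<in>S. odd (g j)}. dirichlet n (g j)) \<le> 2 * odd_harmonic K"
    and "(\<Sum>j\<in>{j\<in>S. even (g j)}. dirichlet n (g j)) \<le> 1"
proof -
  let ?O = "{j\<in>S. odd (g j)}" and ?E = "{j\<in>S. even (g j)}"
  have kr: "dirichlet n (g j) = dirichlet n (symm_mod n (g j))" for j
    by (rule dirichlet_cong) (rule symm_mod_cong)
  have "(\<Sum>j\<in>?O. dirichlet n (g j)) \<le> (\<Sum>j\<in>?O. 1 / \<bar>real_of_int (symm_mod n (g j))\<bar>)"
    unfolding kr by (intro sum_mono dirichlet_odd symm_mod_bound) (simp add: odd_symm_mod)
  also have "\<dots> = (\<Sum>r\<in>(\<lambda>j. symm_mod n (g j)) ` ?O. 1 / \<bar>real_of_int r\<bar>)"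
    by (subst sum.reindex) (auto intro: inj_on_subset[OF inj])
  also have "\<dots> \<le> 2 * odd_harmonic K"
  proof (rule sum_inverse_odd_le)
    show "card ((\<lambda>j. symm_mod n (g j)) ` ?O) \<le> K"
      using card_image_le[of ?O "\<lambda>j. symm_mod n (g j)"] card_mono[OF fin, of ?O] fin card by fastforce
  qed (use fin odd_symm_mod in auto)
  finally show "(\<Sum>j\<in>?O. dirichlet n (g j)) \<le> 2 * odd_harmonic K" .
  let ?Z = "{j\<in>?E. 2 * (2 * int n + 1) dvd g j}"
  have "(\<Sum>j\<in>?E. dirichlet n (g j)) = (\<Sum>j\<in>?Z. dirichlet n (g j))"
    using fin by (intro sum.mono_neutral_right) (auto intro: dirichlet_even)
  also have "\<dots> \<le> (\<Sum>j\<in>?Z. 1)" by (intro sum_mono dirichlet_le_1)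
  also have "card ?Z \<le> 1"
  proof -
    have "j = j'" if "j \<in> ?Z" "j' \<in> ?Z" for j j'
    proof -
      have "2 * (2 * int n + 1) dvd g j - g j'" using that by (auto intro: dvd_diff)
      then have "symm_mod n (g j) = symm_mod n (g j')"
        unfolding symm_mod_def by (simp add: mod_eq_dvd_iff)
      then show ?thesis using inj that by (auto simp: inj_on_def)
    qed
    then show ?thesis by (simp add: card_le_Suc0_iff_eq fin)
  qed
  then have "(\<Sum>j\<in>?Z. 1) \<le> (1::real)" by simp
  finally show "(\<Sum>j\<in>?E. dirichlet n (g j)) \<le> 1" .
qed

lemma inj_on_symm_mod:
  assumes "\<And>j j'. j \<in> S \<Longrightarrow> j' \<in> S \<Longrightarrow> 2 * (2 * int n + 1) dvd g j - g j' \<Longrightarrow> j = j'"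
  shows "inj_on (\<lambda>j. symm_mod n (g j)) S"
  using assms symm_mod_eqD by (auto simp: inj_on_def)

text \<open>All arguments share the parity of \<open>k\<close>, so just one of the two bounds is
  needed: twice \<open>3 / 2 + ln K / 2\<close> for odd \<open>k\<close>, and 1 for even
  \<open>k\<close>.\<close>

lemma dirichlet_row_sum:
  assumes S: "S \<subseteq> {..2 * n}" and card: "card S \<le> K" "K \<ge> 1"
  shows "(\<Sum>j\<in>S. dirichlet n (int k - 2 * int j)) \<le> 3 + ln K"
proof -
  have fin: "finite S" using S finite_subset by blast
  have inj: "inj_on (\<lambda>j. symm_mod n (int k - 2 * int j)) S"
  proof (rule inj_on_symm_mod)
    fix j j' assume j: "j \<in> S" "j' \<in> S" and "2 * (2 * int n + 1) dvd int k - 2 * int j - (int k - 2 * int j')"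
    then have "2 * (2 * int n + 1) dvd 2 * (int j' - int j)" by (simp add: algebra_simps)
    then have "2 * int n + 1 dvd int j' - int j" by (subst (asm) dvd_mult_cancel_left) simp
    then have "int (2 * n + 1) dvd int j' - int j" by (simp add: algebra_simps)
    moreover have "j \<le> 2 * n" "j' \<le> 2 * n" using j S by auto
    ultimately show "j = j'"
      using dvd_diff_window[of "int j'" 0 "2 * n + 1" "int j"] by simp
  qed
  note le = dirichlet_sum_le[OF fin card(1) inj]
  show ?thesis
  proof (cases "odd k")
    case True
    then have "{j\<in>S. odd (int k - 2 * int j)} = S" by auto
    then show ?thesis using le(1) odd_harmonic_le[OF card(2)] by simp
  next
    case False
    then have "{j\<in>S. even (int k - 2 * int j)} = S" by auto
    moreover have "ln (real K) \<ge> 0" using card(2) by simp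
    ultimately show ?thesis using le(2) by simp
  qed
qed

text \<open>Now both parities occur. The bound is 1 + 3 plus the logarithm of the full period, and
  its \<open>ln 2\<close> is rounded up to 1.\<close>

lemma dirichlet_column_sum:
  "(\<Sum>k<2 * (2 * n + 1). dirichlet n (int k - 2 * int j)) \<le> 5 + ln (real (2 * n + 1))"
proof -
  let ?S = "{..<2 * (2 * n + 1)}"
  have inj: "inj_on (\<lambda>k. symm_mod n (int k - 2 * int j)) ?S"
  proof (rule inj_on_symm_mod)
    fix k k' assume "k \<in> ?S" "k' \<in> ?S" "2 * (2 * int n + 1) dvd int k - 2 * int j - (int k' - 2 * int j)"
    then have "int (2 * (2 * n + 1)) dvd int k - int k'" by (simp add: algebra_simps)
    with \<open>k \<in> ?S\<close> \<open>k' \<in> ?S\<close> show "k = k'"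
      using dvd_diff_window[of "int k" 0 "2 * (2 * n + 1)" "int k'"] by simp
  qed
  have split: "sum f S = sum f {k\<in>S. odd (g k)} + sum f {k\<in>S. even (g k)}"
    if "finite S" for f :: "nat \<Rightarrow> real" and g :: "nat \<Rightarrow> int" and S
    using that by (subst sum.union_disjoint[symmetric]) (auto intro!: sum.cong)
  note le = dirichlet_sum_le[of ?S "2 * (2 * n + 1)", OF _ _ inj]
  have "(\<Sum>k\<in>?S. dirichlet n (int k - 2 * int j))
      = (\<Sum>k\<in>{k\<in>?S. odd (int k - 2 * int j)}. dirichlet n (int k - 2 * int j))
      + (\<Sum>k\<in>{k\<in>?S. even (int k - 2 * int j)}. dirichlet n (int k - 2 * int j))"
    by (rule split) simp
  also have "\<dots> \<le> 2 * odd_harmonic (2 * (2 * n + 1)) + 1"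
    using le by (intro add_mono) auto
  also have "\<dots> \<le> 4 + ln (2 * (2 * n + 1))"
    using odd_harmonic_le[of "2 * (2 * n + 1)"] by simp
  also have "ln (real (2 * (2 * n + 1))) = ln 2 + ln (real (2 * n + 1))"
    unfolding of_nat_mult[of 2] of_nat_numeral by (rule ln_mult_pos) simp_all
  also have "4 + (ln 2 + ln (real (2 * n + 1))) \<le> 5 + ln (real (2 * n + 1))"
    using ln_le_minus_one[of 2] by simp
  finally show ?thesis .
qed

section \<open>Filters and their spectra\<close>

text \<open>The DFT of the filter without the factor \<open>1 / sqrt (2 * n + 1)\<close> of \<^const>\<open>dft\<close>.\<close>
definition filter_dft :: "nat \<Rightarrow> (int \<Rightarrow> complex) \<Rightarrow> nat \<Rightarrow> complex" where
  "filter_dft n \<phi> k = (\<Sum>\<tau>\<in>{- int n..int n}. \<phi> \<tau> * chi (2 * n + 1) (- (int k * \<tau>)))"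

lemma cmod_dft: "cmod (dft n \<phi> k) = cmod (filter_dft n \<phi> k) / sqrt (2 * real n + 1)"
proof -
  have "exp (- \<i> * 2 * pi * of_nat k * of_int \<tau> / (2 * of_nat n + 1)) = chi (2 * n + 1) (- (int k * \<tau>))" for \<tau>
    unfolding chi_def cis_conv_exp by (simp add: mult_ac add.commute)
  then have "dft n \<phi> k = complex_of_real (1 / sqrt (2 * real n + 1)) * filter_dft n \<phi> k"
    unfolding dft_def filter_dft_def by (simp add: mult.commute)
  then have "cmod (dft n \<phi> k) = \<bar>1 / sqrt (2 * real n + 1)\<bar> * cmod (filter_dft n \<phi> k)"
    by (simp only: norm_mult norm_of_real)
  then show ?thesis by simp
qed

text \<open>Cancelling \<open>sqrt (2 * n + 1)\<close> exhibits the constraints as a capped simplex: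
  cap \<open>c_star\<close>, total \<open>18 * s\<close> times the cap.\<close>

lemma feasibleD:
  assumes "feasible s n \<phi>" "s \<ge> 1"
  shows "\<phi> \<in> Cn n" "(\<Sum>k\<le>2 * n. cmod (filter_dft n \<phi> k)) \<le> c_star * real (18 * s)"
    "k \<le> 2 * n \<Longrightarrow> cmod (filter_dft n \<phi> k) \<le> c_star"
proof -
  let ?r = "sqrt (2 * real n + 1)"
  have r: "?r > 0" by simp
  show "\<phi> \<in> Cn n" using assms by (simp add: feasible_def)
  have 1: "dft_l1 n \<phi> \<le> 18 * c_star * real s / ?r"
    and 2: "18 * real s * dft_linf n \<phi> \<le> 18 * c_star * real s / ?r"
    using assms by (auto simp: feasible_def)
  from 1 have "(\<Sum>k\<le>2 * n. cmod (filter_dft n \<phi> k)) / ?r \<le> 18 * c_star * real s / ?r"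
    by (simp add: dft_l1_def cmod_dft sum_divide_distrib)
  then show "(\<Sum>k\<le>2 * n. cmod (filter_dft n \<phi> k)) \<le> c_star * real (18 * s)"
    using r by (simp add: divide_le_cancel mult.commute mult.left_commute)
  assume k: "k \<le> 2 * n"
  have "cmod (dft n \<phi> k) \<le> dft_linf n \<phi>"
    unfolding dft_linf_def using k by (intro Max_ge) auto
  then have "18 * real s * (cmod (filter_dft n \<phi> k) / ?r) \<le> 18 * real s * dft_linf n \<phi>"
    unfolding cmod_dft by (intro mult_left_mono) auto
  with 2 have "18 * real s * cmod (filter_dft n \<phi> k) / ?r \<le> 18 * real s * c_star / ?r"
    by (simp add: mult_ac)
  then show "cmod (filter_dft n \<phi> k) \<le> c_star"
    using r assms(2) by (simp add: divide_le_cancel)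
qed

lemma feasibleI:
  assumes "\<phi> \<in> Cn n" "(\<Sum>k\<le>2 * n. cmod (filter_dft n \<phi> k)) \<le> c_star * real (18 * s)"
    "\<And>k. k \<le> 2 * n \<Longrightarrow> cmod (filter_dft n \<phi> k) \<le> c_star"
  shows "feasible s n \<phi>"
proof -
  let ?r = "sqrt (2 * real n + 1)"
  have r: "?r > 0" by simp
  have "dft_l1 n \<phi> = (\<Sum>k\<le>2 * n. cmod (filter_dft n \<phi> k)) / ?r"
    by (simp add: dft_l1_def cmod_dft sum_divide_distrib)
  also have "\<dots> \<le> c_star * real (18 * s) / ?r"
    using assms(2) r by (intro divide_right_mono) auto
  finally have 1: "dft_l1 n \<phi> \<le> 18 * c_star * real s / ?r" by (simp add: mult_ac)
  have "dft_linf n \<phi> \<le> c_star / ?r"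
    unfolding dft_linf_def using assms(3) r
    by (intro Max.boundedI) (auto simp: cmod_dft intro!: divide_right_mono)
  then have "18 * real s * dft_linf n \<phi> \<le> 18 * real s * (c_star / ?r)"
    by (intro mult_left_mono) auto
  with 1 assms(1) show ?thesis by (simp add: feasible_def mult_ac)
qed

lemma conv_Cn:
  assumes "\<phi> \<in> Cn n"
  shows "conv \<phi> v t = (\<Sum>\<tau>\<in>{- int n..int n}. \<phi> \<tau> * v (t - \<tau>))"
proof -
  have "conv \<phi> v t = (\<Sum>\<^sub>\<infinity>\<tau>\<in>{- int n..int n}. \<phi> \<tau> * v (t - \<tau>))"
    unfolding conv_def using assms
    by (intro infsum_cong_neutral) (auto simp: Cn_def)
  then show ?thesis by simp
qed

text \<open>
  Averaging the orthogonal projector onto the signals restricted to \<open>{-m..m}\<close> along its diagonals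
  gives a reproducing filter whose Fourier transform is a quadratic form of the projector: it lies
  in \<open>[0, 1]\<close>, and its mean is the normalized trace.
\<close>
lemma reproducing_filter:
  assumes mn: "2 * m \<le> n"
  obtains \<phi> where "\<phi> \<in> Cn n"
    "\<And>x t. x \<in> Xset s w \<Longrightarrow> conv \<phi> x t = x t"
    "\<And>k. cmod (filter_dft n \<phi> k) \<le> 1"
    "(\<Sum>k\<le>2 * n. cmod (filter_dft n \<phi> k)) \<le> real (2 * n + 1) * real s / real (2 * m + 1)"
proof -
  let ?W = "{- int m..int m}" and ?N = "2 * n + 1" and ?M = "2 * m + 1"
  obtain d u where d: "d \<le> s" and on: "orthonormal ?W d u"
    and rep: "\<And>x t. x \<in> Xset s w \<Longrightarrow> t \<in> ?W \<Longrightarrow>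
       x t = (\<Sum>i<d. (\<Sum>r\<in>?W. x r * cnj (u i r)) * u i t)"
    by (rule Xset_orthonormal_basis[where s = s and w = w and a = "- int m" and b = "int m"]) blast
  define Pr where "Pr t r = (\<Sum>i<d. u i t * cnj (u i r))" for t r
  \<comment> \<open>The entry at \<open>v\<close> collects the diagonal \<open>t - r = v\<close>,
    hence support in \<open>{-2m..2m}\<close>. Every diagonal is divided by the same
    \<open>2m + 1\<close>, whatever its length, which makes the convolution an average over
    rows.\<close>
  define \<phi> where "\<phi> v = (\<Sum>t\<in>?W. \<Sum>r\<in>?W. if t - r = v then Pr t r else 0) / of_nat ?M" for v
  have card: "(\<Sum>t\<in>?W. 1::complex) = of_nat ?M"
  proof -
    have "card ?W = ?M" by simp
    then show ?thesis by (simp only: sum_constant mult_1_right)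
  qed
  have sum_phi: "(\<Sum>v\<in>{- int n..int n}. \<phi> v * F v)
      = (\<Sum>t\<in>?W. \<Sum>r\<in>?W. Pr t r * F (t - r)) / of_nat ?M" for F
  proof -
    have "(\<Sum>v\<in>{- int n..int n}. \<phi> v * F v)
        = (\<Sum>v\<in>{- int n..int n}. \<Sum>t\<in>?W. \<Sum>r\<in>?W. if t - r = v then Pr t r * F v else 0) / of_nat ?M"
      unfolding \<phi>_def times_divide_eq_left sum_distrib_right sum_divide_distrib[symmetric]
        if_distrib[where f = "\<lambda>z. z * F v" for v] mult_zero_left ..
    also have "(\<Sum>v\<in>{- int n..int n}. \<Sum>t\<in>?W. \<Sum>r\<in>?W. if t - r = v then Pr t r * F v else 0)
        = (\<Sum>t\<in>?W. \<Sum>r\<in>?W. \<Sum>v\<in>{- int n..int n}. if t - r = v then Pr t r * F v else 0)"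
      by (subst sum.swap, rule sum.cong, simp, subst sum.swap, simp)
    also have "\<dots> = (\<Sum>t\<in>?W. \<Sum>r\<in>?W. Pr t r * F (t - r))"
      using mn by (intro sum.cong) (auto simp: sum.delta')
    finally show ?thesis .
  qed
  have Cn: "\<phi> \<in> Cn n"
    using mn by (auto simp: Cn_def \<phi>_def intro!: sum.neutral)
  have conv: "conv \<phi> x t = x t" if x: "x \<in> Xset s w" for x t
  proof -
    \<comment> \<open>Row \<open>q\<close> of the projector recovers the value at \<open>q\<close>
      of the signal shifted so that time \<open>t\<close> falls on \<open>q\<close>; shifted signals
      are signals. Averaging over \<open>q\<close> gives the reproduction.\<close>
    have "(\<Sum>r\<in>?W. Pr q r * x (t - (q - r))) = x t" if q: "q \<in> ?W" for q
    proof -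
      have "x t = (\<lambda>r. x (r - (q - t))) q" by simp
      also have "\<dots> = (\<Sum>i<d. (\<Sum>r\<in>?W. x (r - (q - t)) * cnj (u i r)) * u i q)"
        by (rule rep[OF Xset_shift[OF x] q])
      also have "\<dots> = (\<Sum>r\<in>?W. Pr q r * x (r - (q - t)))"
        unfolding Pr_def sum_distrib_right by (subst sum.swap) (simp add: mult_ac)
      finally show ?thesis by (simp add: algebra_simps)
    qed
    then have "conv \<phi> x t = (\<Sum>q\<in>?W. x t * 1) / of_nat ?M"
      unfolding conv_Cn[OF Cn] sum_phi by simp
    also have "\<dots> = x t"
      unfolding sum_distrib_left[symmetric] card by (simp del: of_nat_Suc of_nat_add)
    finally show ?thesis .
  qed
  define v where "v k i = (\<Sum>t\<in>?W. u i t * chi ?N (- (int k * t)))" for k i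
  have spec: "filter_dft n \<phi> k = complex_of_real ((\<Sum>i<d. (cmod (v k i))\<^sup>2) / ?M)" for k
  proof -
    have "(\<Sum>t\<in>?W. \<Sum>r\<in>?W. Pr t r * chi ?N (- (int k * (t - r))))
        = (\<Sum>t\<in>?W. \<Sum>r\<in>?W. \<Sum>i<d. (u i t * chi ?N (- (int k * t))) * cnj (u i r * chi ?N (- (int k * r))))"
      unfolding Pr_def sum_distrib_right
    proof (intro sum.cong refl)
      fix t r i
      have "- (int k * (t - r)) = - (int k * t) + int k * r" by (simp add: algebra_simps)
      then have "chi ?N (- (int k * (t - r))) = chi ?N (- (int k * t)) * chi ?N (int k * r)"
        by (simp only: chi_add)
      then show "u i t * cnj (u i r) * chi ?N (- (int k * (t - r)))
          = (u i t * chi ?N (- (int k * t))) * cnj (u i r * chi ?N (- (int k * r)))"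
        by (simp add: cnj_chi mult_ac)
    qed
    also have "\<dots> = (\<Sum>i<d. v k i * cnj (v k i))"
      unfolding v_def cnj_sum sum_product
      by (subst sum.swap[where A = "{..<d}"], rule sum.cong, simp, subst sum.swap[where A = "{..<d}"], simp)
    also have "\<dots> = complex_of_real (\<Sum>i<d. (cmod (v k i))\<^sup>2)"
      by (simp add: of_real_cmod_power2)
    finally show ?thesis
      unfolding filter_dft_def sum_phi by simp
  qed
  then have cspec: "cmod (filter_dft n \<phi> k) = (\<Sum>i<d. (cmod (v k i))\<^sup>2) / ?M" for k
    by (simp only: norm_of_real) (simp add: sum_nonneg)
  have le1: "cmod (filter_dft n \<phi> k) \<le> 1" for k
  proof -
    \<comment> \<open>Up to conjugation, \<open>v k i\<close> is the coefficient of a character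
      along \<open>u i\<close>. Bessel bounds their total by the squared norm of the character on
      the window, which is \<open>2 * m + 1\<close>.\<close>
    have eq: "cmod (v k i) = cmod (\<Sum>t\<in>?W. chi ?N (int k * t) * cnj (u i t))" for i
    proof -
      have "cnj (v k i) = (\<Sum>t\<in>?W. chi ?N (int k * t) * cnj (u i t))"
        by (simp add: v_def cnj_chi mult.commute)
      then show ?thesis by (metis complex_mod_cnj)
    qed
    have "(\<Sum>i<d. (cmod (v k i))\<^sup>2) \<le> (\<Sum>t\<in>?W. (cmod (chi ?N (int k * t)))\<^sup>2)"
      unfolding eq by (rule orthonormal_bessel[OF on])
    also have "\<dots> = ?M" by simp
    finally show ?thesis unfolding cspec by (simp add: divide_le_eq)
  qed
  have "(\<Sum>k\<le>2 * n. cmod (filter_dft n \<phi> k)) = (\<Sum>i<d. \<Sum>k<?N. (cmod (v k i))\<^sup>2) / ?M"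
    unfolding cspec sum_divide_distrib[symmetric]
    by (subst sum.swap) (simp add: lessThan_Suc_atMost)
  also have "(\<Sum>i<d. \<Sum>k<?N. (cmod (v k i))\<^sup>2) = (\<Sum>i<d. real ?N)"
  proof (rule sum.cong)
    fix i assume i: "i \<in> {..<d}"
    \<comment> \<open>The window fits into one period, so each basis vector contributes exactly
      \<open>?N\<close> over all frequencies.\<close>
    have "(\<Sum>k<?N. (cmod (v k i))\<^sup>2) = real ?N * (\<Sum>t\<in>?W. (cmod (u i t))\<^sup>2)"
      unfolding v_def by (rule parseval_chi_window[where a = "- int n"]) (use mn in auto)
    also have "complex_of_real (\<Sum>t\<in>?W. (cmod (u i t))\<^sup>2) = 1"
      using on i by (simp add: of_real_cmod_power2 orthonormal_def)
    then have "(\<Sum>t\<in>?W. (cmod (u i t))\<^sup>2) = 1" by (simp only: of_real_eq_1_iff)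
    finally show "(\<Sum>k<?N. (cmod (v k i))\<^sup>2) = real ?N" by simp
  qed simp
  also have "(\<Sum>i<d. real ?N) / ?M \<le> real ?N * real s / ?M"
    using d by (intro divide_right_mono) (auto simp: mult.commute intro!: mult_left_mono)
  finally show thesis using that[OF Cn conv le1] by blast
qed

section \<open>The spectrum on the doubled frequency grid\<close>

definition filter_dft2 :: "nat \<Rightarrow> (int \<Rightarrow> complex) \<Rightarrow> nat \<Rightarrow> complex" where
  "filter_dft2 n \<phi> k = (\<Sum>\<tau>\<in>{- int n..int n}. \<phi> \<tau> * chi (2 * (2 * n + 1)) (- (int k * \<tau>)))"

lemma filter_dft_inversion:
  assumes "t \<in> {- int n..int n}"
  shows "\<phi> t = (\<Sum>j\<le>2 * n. filter_dft n \<phi> j * chi (2 * n + 1) (int j * t)) / of_nat (2 * n + 1)"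
proof -
  let ?N = "2 * n + 1" and ?W = "{- int n..int n}"
  have "(\<Sum>j\<le>2 * n. filter_dft n \<phi> j * chi ?N (int j * t))
      = (\<Sum>\<tau>\<in>?W. \<phi> \<tau> * (\<Sum>j<?N. chi ?N (int j * (t - \<tau>))))"
    unfolding filter_dft_def sum_distrib_right sum_distrib_left
    by (subst sum.swap)
      (simp add: lessThan_Suc_atMost right_diff_distrib mult.assoc flip: chi_add)
  also have "\<dots> = (\<Sum>\<tau>\<in>?W. if t = \<tau> then \<phi> \<tau> * of_nat ?N else 0)"
  proof (rule sum.cong)
    fix \<tau> assume "\<tau> \<in> ?W"
    then have "int ?N dvd t - \<tau> \<longleftrightarrow> t = \<tau>"
      using assms unfolding symmetric_window by (intro dvd_diff_window)
    moreover have "0 < ?N" by simp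
    ultimately have "(\<Sum>j<?N. chi ?N (int j * (t - \<tau>))) = (if t = \<tau> then of_nat ?N else 0)"
      by (simp only: sum_chi)
    then show "\<phi> \<tau> * (\<Sum>j<?N. chi ?N (int j * (t - \<tau>))) = (if t = \<tau> then \<phi> \<tau> * of_nat ?N else 0)"
      by (simp only:) simp
  qed simp
  also have "\<dots> = \<phi> t * of_nat ?N" using assms by simp
  finally show ?thesis by (simp del: of_nat_Suc of_nat_add)
qed

lemma dirichlet_uminus: "dirichlet n (- l) = dirichlet n l"
proof -
  have "cnj (\<Sum>t\<in>{- int n..int n}. chi (2 * (2 * n + 1)) (t * l))
      = (\<Sum>t\<in>{- int n..int n}. chi (2 * (2 * n + 1)) (t * - l))"
    by (simp add: cnj_chi)
  then show ?thesis unfolding dirichlet_def by (metis complex_mod_cnj)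
qed

text \<open>Trigonometric interpolation: inserting the inversion formula writes the finer transform
  as a combination of kernels centred at the DFT frequencies, which are the even points
  \<open>2 * j\<close> of the doubled grid.\<close>

lemma cmod_filter_dft2_le:
  "cmod (filter_dft2 n \<phi> k) \<le> (\<Sum>j\<le>2 * n. cmod (filter_dft n \<phi> j) * dirichlet n (int k - 2 * int j))"
proof -
  let ?N = "2 * n + 1" and ?W = "{- int n..int n}"
  have "filter_dft2 n \<phi> k = (\<Sum>\<tau>\<in>?W. (\<Sum>j\<le>2 * n. filter_dft n \<phi> j * chi ?N (int j * \<tau>)) / of_nat ?N * chi (2 * ?N) (- (int k * \<tau>)))"
    unfolding filter_dft2_def by (intro sum.cong arg_cong2[where f = "(*)"] filter_dft_inversion) auto
  also have "\<dots> = (\<Sum>j\<le>2 * n. filter_dft n \<phi> j * ((\<Sum>\<tau>\<in>?W. chi (2 * ?N) (\<tau> * - (int k - 2 * int j))) / of_nat ?N))"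
  proof -
    have "chi ?N (int j * \<tau>) * chi (2 * ?N) (- (int k * \<tau>)) = chi (2 * ?N) (\<tau> * - (int k - 2 * int j))" for j \<tau>
    proof -
      have "\<tau> * - (int k - 2 * int j) = 2 * (int j * \<tau>) + - (int k * \<tau>)" by (simp add: algebra_simps)
      then show ?thesis by (simp only: chi_add chi_double)
    qed
    then have "(\<Sum>j\<le>2 * n. filter_dft n \<phi> j * chi ?N (int j * \<tau>)) / of_nat ?N * chi (2 * ?N) (- (int k * \<tau>))
        = (\<Sum>j\<le>2 * n. filter_dft n \<phi> j * (chi (2 * ?N) (\<tau> * - (int k - 2 * int j)) / of_nat ?N))" for \<tau>
      unfolding sum_divide_distrib sum_distrib_right
      by (simp only: times_divide_eq_left times_divide_eq_right mult.assoc)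
    then show ?thesis
      unfolding sum_divide_distrib sum_distrib_left by (simp only:) (rule sum.swap)
  qed
  finally have "cmod (filter_dft2 n \<phi> k)
      \<le> (\<Sum>j\<le>2 * n. cmod (filter_dft n \<phi> j * ((\<Sum>\<tau>\<in>?W. chi (2 * ?N) (\<tau> * - (int k - 2 * int j))) / of_nat ?N)))"
    by (simp only: norm_sum)
  also have "\<dots> = (\<Sum>j\<le>2 * n. cmod (filter_dft n \<phi> j) * dirichlet n (- (int k - 2 * int j)))"
    unfolding dirichlet_def norm_mult norm_divide norm_of_nat ..
  finally show ?thesis unfolding dirichlet_uminus .
qed

text \<open>A linear form with nonnegative coefficients is maximal at an extreme point of the capped simplex.\<close>
lemma capped_sum_le:
  fixes a H :: "'j \<Rightarrow> real"
  assumes fin: "finite J" and K: "K \<ge> 1" and c: "c \<ge> 0"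
    and a: "\<And>j. j \<in> J \<Longrightarrow> 0 \<le> a j \<and> a j \<le> c" and sum_a: "sum a J \<le> c * real K"
    and H: "\<And>j. j \<in> J \<Longrightarrow> 0 \<le> H j"
    and g: "\<And>S. S \<subseteq> J \<Longrightarrow> card S \<le> K \<Longrightarrow> sum H S \<le> g"
  shows "(\<Sum>j\<in>J. a j * H j) \<le> c * g"
proof (cases "card J \<le> K")
  case True
  have "(\<Sum>j\<in>J. a j * H j) \<le> (\<Sum>j\<in>J. c * H j)"
    using a H by (intro sum_mono mult_right_mono) auto
  also have "\<dots> = c * sum H J" by (simp add: sum_distrib_left)
  also have "\<dots> \<le> c * g" using g[of J] True c by (intro mult_left_mono) auto
  finally show ?thesis .
next
  case False
  let ?F = "{S. S \<subseteq> J \<and> card S = K}"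
  have "finite ?F" using fin by simp
  moreover have "?F \<noteq> {}"
    using False obtain_subset_with_card_n[of K J] by auto
  ultimately have "Max (sum H ` ?F) \<in> sum H ` ?F" by (intro Max_in) simp_all
  then obtain S where S: "S \<in> ?F" and "sum H S = Max (sum H ` ?F)" by (metis (no_types, lifting) imageE)
  then have max: "sum H S' \<le> sum H S" if "S' \<in> ?F" for S'
    using that \<open>finite ?F\<close> by simp
  have finS: "finite S" using S fin finite_subset by auto
  have "S \<noteq> {}" using S K by auto
  \<comment> \<open>The multiplier of the sum constraint. Optimality of \<open>S\<close> puts every
    \<open>H\<close> outside \<open>S\<close> below it, by exchanging an index.\<close>
  define h where "h = Min (H ` S)"
  have hS: "h \<le> H j" if "j \<in> S" for j
    using that finS by (simp add: h_def)
  have hJ: "H j \<le> h" if j: "j \<in> J - S" for j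
  proof -
    have "h \<in> H ` S" unfolding h_def using finS \<open>S \<noteq> {}\<close> by (intro Min_in) auto
    then obtain i where i: "i \<in> S" "H i = h" by auto
    have "insert j (S - {i}) \<in> ?F"
    proof -
      have "card (insert j (S - {i})) = Suc (card (S - {i}))"
        using j finS by (intro card_insert_disjoint) auto
      also have "\<dots> = card S" by (rule card_Suc_Diff1[OF finS i(1)])
      finally show ?thesis using S j by auto
    qed
    from max[OF this] have "H j + sum H (S - {i}) \<le> sum H S"
      using j finS by (simp add: sum.insert)
    then show ?thesis using i finS by (simp add: sum.remove[of S i H])
  qed
  have h0: "0 \<le> h" using hJ[of] H \<open>S \<noteq> {}\<close> S finS unfolding h_def by (subst Min_ge_iff) auto
  have split: "sum f J = sum f S + sum f (J - S)" for f :: "'j \<Rightarrow> real"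
    using S fin sum.subset_diff[of S J f] by (simp add: add.commute)
  \<comment> \<open>Termwise this is \<open>(a j - c) * (H j - h) <= 0\<close>. With
    \<open>H j <= h\<close> outside \<open>S\<close>, only \<open>h\<close> times the defect in the
    sum constraint is left over.\<close>
  have "(\<Sum>j\<in>S. a j * H j) \<le> (\<Sum>j\<in>S. c * H j + h * (a j - c))"
  proof (rule sum_mono)
    fix j assume j: "j \<in> S"
    then have "a j \<le> c" using a S by auto
    then have "(c - a j) * h \<le> (c - a j) * H j" using hS[OF j] by (intro mult_left_mono) auto
    then show "a j * H j \<le> c * H j + h * (a j - c)" by (simp add: algebra_simps)
  qed
  moreover have "(\<Sum>j\<in>J - S. a j * H j) \<le> (\<Sum>j\<in>J - S. h * a j)"
    using a hJ by (intro sum_mono) (metis DiffD1 mult.commute mult_left_mono)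
  ultimately have "(\<Sum>j\<in>J. a j * H j) \<le> c * sum H S + h * (sum a J - c * real K)"
    using S unfolding split[of "\<lambda>j. a j * H j"] split[of a]
    by (simp add: sum.distrib sum_subtractf flip: sum_distrib_left) (simp add: algebra_simps)
  also have "\<dots> \<le> c * sum H S + 0"
    using h0 sum_a by (intro add_left_mono mult_nonneg_nonpos) auto
  also have "\<dots> \<le> c * g" using g[of S] S c by (simp add: mult_left_mono)
  finally show ?thesis .
qed

text \<open>The periodogram of the part of \<open>v\<close> on \<open>T\<close>, on the doubled
  grid, scaled so that the coefficient rows are contractive.\<close>

definition energy :: "nat \<Rightarrow> int set \<Rightarrow> (int \<Rightarrow> complex) \<Rightarrow> nat \<Rightarrow> real" where
  "energy n T v k = (cmod (\<Sum>t\<in>T. v t * chi (2 * (2 * n + 1)) (- (int k * t))))\<^sup>2 / real (2 * (2 * n + 1))"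

lemma energy_nonneg: "0 \<le> energy n T v k"
  by (simp add: energy_def)

text \<open>
  Padding to length \<open>2 * (2 * n + 1)\<close> makes the convolution of a filter in \<open>Cn n\<close> with noise on
  \<open>{-2n..2n}\<close> circular, without wrap-around on the output window \<open>{-n..n}\<close>.
\<close>
lemma conv_circular:
  assumes "\<phi> \<in> Cn n" "t \<in> {- int n..int n}"
  shows "conv \<phi> v t = (\<Sum>k<2 * (2 * n + 1). filter_dft2 n \<phi> k
      * (\<Sum>r\<in>{- 2 * int n..2 * int n}. v r * chi (2 * (2 * n + 1)) (- (int k * r)))
      * chi (2 * (2 * n + 1)) (int k * t)) / of_nat (2 * (2 * n + 1))"
proof -
  let ?N = "2 * (2 * n + 1)" and ?W = "{- int n..int n}" and ?I = "{- 2 * int n..2 * int n}"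
  have "(\<Sum>k<?N. filter_dft2 n \<phi> k * (\<Sum>r\<in>?I. v r * chi ?N (- (int k * r))) * chi ?N (int k * t))
      = (\<Sum>k<?N. \<Sum>\<tau>\<in>?W. \<Sum>r\<in>?I. \<phi> \<tau> * v r * chi ?N (int k * (t - \<tau> - r)))"
    unfolding filter_dft2_def unfolding sum_product unfolding sum_distrib_right
  proof (intro sum.cong refl)
    fix k \<tau> r
    have "int k * (t - \<tau> - r) = - (int k * \<tau>) + (- (int k * r) + int k * t)" by (simp add: algebra_simps)
    then show "\<phi> \<tau> * chi ?N (- (int k * \<tau>)) * (v r * chi ?N (- (int k * r))) * chi ?N (int k * t)
        = \<phi> \<tau> * v r * chi ?N (int k * (t - \<tau> - r))"
      by (simp only: chi_add mult_ac)
  qed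
  also have "\<dots> = (\<Sum>\<tau>\<in>?W. \<Sum>r\<in>?I. \<phi> \<tau> * v r * (\<Sum>k<?N. chi ?N (int k * (t - \<tau> - r))))"
    unfolding sum_distrib_left
    by (subst sum.swap, rule sum.cong, simp, subst sum.swap, simp)
  also have "\<dots> = (\<Sum>\<tau>\<in>?W. \<Sum>r\<in>?I. if t - \<tau> = r then \<phi> \<tau> * v r * of_nat ?N else 0)"
  proof (intro sum.cong refl)
    fix \<tau> r assume "\<tau> \<in> ?W" "r \<in> ?I"
    \<comment> \<open>Both indices lie among the \<open>4 * n + 1\<close> points of the noise
      window, one fewer than the modulus.\<close>
    then have "t - \<tau> \<in> {- 2 * int n..<- 2 * int n + int ?N}" "r \<in> {- 2 * int n..<- 2 * int n + int ?N}"
      using assms(2) by auto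
    then have "int ?N dvd t - \<tau> - r \<longleftrightarrow> t - \<tau> = r" by (rule dvd_diff_window)
    moreover have "0 < ?N" by simp
    ultimately have "(\<Sum>k<?N. chi ?N (int k * (t - \<tau> - r))) = (if t - \<tau> = r then of_nat ?N else 0)"
      by (simp only: sum_chi)
    then show "\<phi> \<tau> * v r * (\<Sum>k<?N. chi ?N (int k * (t - \<tau> - r)))
        = (if t - \<tau> = r then \<phi> \<tau> * v r * of_nat ?N else 0)"
      by (simp only:) simp
  qed
  also have "\<dots> = (\<Sum>\<tau>\<in>?W. \<phi> \<tau> * v (t - \<tau>) * of_nat ?N)"
    using assms(2) by (intro sum.cong) (auto simp: sum.delta')
  also have "\<dots> = conv \<phi> v t * of_nat ?N"
    unfolding conv_Cn[OF assms(1)] sum_distrib_right ..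
  finally show ?thesis by (simp del: of_nat_Suc of_nat_add of_nat_mult)
qed

text \<open>Parseval on the padded circle; it is an inequality because only outputs in the window
  are counted.\<close>

lemma conv_energy_le:
  assumes "\<phi> \<in> Cn n"
  shows "(\<Sum>t\<in>{- int n..int n}. (cmod (conv \<phi> v t))\<^sup>2)
    \<le> (\<Sum>k<2 * (2 * n + 1). (cmod (filter_dft2 n \<phi> k))\<^sup>2 * energy n {- 2 * int n..2 * int n} v k)"
proof -
  let ?N = "2 * (2 * n + 1)" and ?W = "{- int n..int n}" and ?I = "{- 2 * int n..2 * int n}"
  define V where "V k = (\<Sum>r\<in>?I. v r * chi ?N (- (int k * r)))" for k
  define g where "g k = filter_dft2 n \<phi> k * V k / of_nat ?N" for k
  have "(\<Sum>t\<in>?W. (cmod (conv \<phi> v t))\<^sup>2) = (\<Sum>t\<in>?W. (cmod (\<Sum>k<?N. g k * chi ?N (int k * t)))\<^sup>2)"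
  proof (intro sum.cong refl arg_cong[where f = "\<lambda>z. (cmod z)\<^sup>2"])
    fix t assume "t \<in> ?W"
    then show "conv \<phi> v t = (\<Sum>k<?N. g k * chi ?N (int k * t))"
      using conv_circular[OF assms, of t v]
      by (simp only: g_def V_def sum_divide_distrib times_divide_eq_left)
  qed
  also have "\<dots> \<le> real ?N * (\<Sum>k<?N. (cmod (g k))\<^sup>2)"
    by (rule parseval_chi_grid[where a = "- int n"]) auto
  also have "\<dots> = (\<Sum>k<?N. (cmod (filter_dft2 n \<phi> k))\<^sup>2 * energy n ?I v k)"
    unfolding sum_distrib_left
  proof (intro sum.cong refl)
    fix k
    have "real ?N * (cmod (g k))\<^sup>2 = real ?N * ((cmod (filter_dft2 n \<phi> k))\<^sup>2 * (cmod (V k))\<^sup>2 / (real ?N)\<^sup>2)"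
      unfolding g_def norm_divide norm_mult norm_of_nat power_divide power_mult_distrib ..
    also have "\<dots> = (cmod (filter_dft2 n \<phi> k))\<^sup>2 * ((cmod (V k))\<^sup>2 / real ?N)"
      by (simp add: power2_eq_square del: of_nat_Suc of_nat_add of_nat_mult)
    finally show "real ?N * (cmod (g k))\<^sup>2 = (cmod (filter_dft2 n \<phi> k))\<^sup>2 * energy n ?I v k"
      unfolding energy_def V_def .
  qed
  finally show ?thesis .
qed

text \<open>The convolution sees noise on \<open>{-2n..2n}\<close> and the other factor only noise
  on \<open>{-n..n}\<close>. The arithmetic-geometric mean inequality separates them into two
  periodograms, which is why both windows have to be controlled.\<close>

lemma conv_inner_le:
  assumes "\<phi> \<in> Cn n"
  shows "2 * cmod (\<Sum>t\<in>{- int n..int n}. conv \<phi> v t * cnj (v t))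
    \<le> (\<Sum>k<2 * (2 * n + 1). cmod (filter_dft2 n \<phi> k) * energy n {- 2 * int n..2 * int n} v k)
      + (\<Sum>k<2 * (2 * n + 1). cmod (filter_dft2 n \<phi> k) * energy n {- int n..int n} v k)"
proof -
  let ?N = "2 * (2 * n + 1)" and ?W = "{- int n..int n}" and ?I = "{- 2 * int n..2 * int n}"
  define V where "V T k = (\<Sum>r\<in>T. v r * chi ?N (- (int k * r)))" for T k
  have en: "energy n T v k = (cmod (V T k))\<^sup>2 / real ?N" for T k
    by (simp add: energy_def V_def)
  have "(\<Sum>t\<in>?W. conv \<phi> v t * cnj (v t))
      = (\<Sum>t\<in>?W. \<Sum>k<?N. filter_dft2 n \<phi> k * V ?I k * (cnj (v t) * chi ?N (int k * t)) / of_nat ?N)"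
  proof (intro sum.cong refl)
    fix t assume "t \<in> ?W"
    show "conv \<phi> v t * cnj (v t) = (\<Sum>k<?N. filter_dft2 n \<phi> k * V ?I k * (cnj (v t) * chi ?N (int k * t)) / of_nat ?N)"
      unfolding conv_circular[OF assms \<open>t \<in> ?W\<close>] V_def[symmetric] sum_divide_distrib sum_distrib_right
      by (intro sum.cong refl) (simp only: times_divide_eq_left times_divide_eq_right mult_ac)
  qed
  also have "\<dots> = (\<Sum>k<?N. filter_dft2 n \<phi> k * V ?I k * cnj (V ?W k) / of_nat ?N)"
  proof (subst sum.swap, intro sum.cong refl)
    fix k
    have "cnj (V ?W k) = (\<Sum>t\<in>?W. cnj (v t) * chi ?N (int k * t))"
      by (simp add: V_def cnj_chi)
    then show "(\<Sum>t\<in>?W. filter_dft2 n \<phi> k * V ?I k * (cnj (v t) * chi ?N (int k * t)) / of_nat ?N)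
        = filter_dft2 n \<phi> k * V ?I k * cnj (V ?W k) / of_nat ?N"
      by (simp only: sum_distrib_left sum_divide_distrib)
  qed
  finally have "cmod (\<Sum>t\<in>?W. conv \<phi> v t * cnj (v t))
      \<le> (\<Sum>k<?N. cmod (filter_dft2 n \<phi> k * V ?I k * cnj (V ?W k) / of_nat ?N))"
    by (simp only: norm_sum)
  also have "\<dots> \<le> (\<Sum>k<?N. (cmod (filter_dft2 n \<phi> k) * energy n ?I v k + cmod (filter_dft2 n \<phi> k) * energy n ?W v k) / 2)"
  proof (rule sum_mono)
    fix k
    let ?a = "cmod (V ?I k)" and ?b = "cmod (V ?W k)"
    have "2 * (?a * ?b) \<le> ?a\<^sup>2 + ?b\<^sup>2"
      using sum_squares_bound[of ?a ?b] by simp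
    then have "?a * ?b \<le> (?a\<^sup>2 + ?b\<^sup>2) / 2" by simp
    then have "cmod (filter_dft2 n \<phi> k) / real ?N * (?a * ?b) \<le> cmod (filter_dft2 n \<phi> k) / real ?N * ((?a\<^sup>2 + ?b\<^sup>2) / 2)"
      by (rule mult_left_mono) simp
    then show "cmod (filter_dft2 n \<phi> k * V ?I k * cnj (V ?W k) / of_nat ?N)
        \<le> (cmod (filter_dft2 n \<phi> k) * energy n ?I v k + cmod (filter_dft2 n \<phi> k) * energy n ?W v k) / 2"
      unfolding en norm_divide norm_mult norm_of_nat complex_mod_cnj
      by (simp add: add_divide_distrib distrib_left mult.assoc del: of_nat_Suc of_nat_add of_nat_mult)
  qed
  also have "\<dots> = ((\<Sum>k<?N. cmod (filter_dft2 n \<phi> k) * energy n ?I v k)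
      + (\<Sum>k<?N. cmod (filter_dft2 n \<phi> k) * energy n ?W v k)) / 2"
    unfolding sum_divide_distrib[symmetric] sum.distrib ..
  finally show ?thesis by simp
qed

section \<open>The oracle inequality and the confidence bound\<close>

lemma c_star_ge: "c_star \<ge> 25"
proof -
  have "pi\<^sup>2 \<ge> 3\<^sup>2" using pi_gt3 by (intro power_mono) auto
  then show ?thesis by (simp add: c_star_def)
qed

text \<open>After interpolation and an exchange of sums the left side is linear in the moduli of the
  DFT, which range over a capped simplex. Hence it suffices to control sums over small sets of
  kernels.\<close>

lemma feasible_energy_le:
  assumes \<phi>: "feasible s n \<phi>" and s: "s \<ge> 1" and E: "\<And>k. 0 \<le> E k"
    and g: "\<And>S. S \<subseteq> {..2 * n} \<Longrightarrow> card S \<le> 18 * s \<Longrightarrow>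
      (\<Sum>k<2 * (2 * n + 1). (\<Sum>j\<in>S. dirichlet n (int k - 2 * int j)) * E k) \<le> g"
  shows "(\<Sum>k<2 * (2 * n + 1). cmod (filter_dft2 n \<phi> k) * E k) \<le> c_star * g"
proof -
  let ?N = "2 * (2 * n + 1)"
  define H where "H j = (\<Sum>k<?N. dirichlet n (int k - 2 * int j) * E k)" for j
  have swap: "(\<Sum>j\<in>S. a j * H j) = (\<Sum>k<?N. (\<Sum>j\<in>S. a j * dirichlet n (int k - 2 * int j)) * E k)" for S a
    unfolding H_def sum_distrib_left sum_distrib_right by (subst sum.swap) (simp only: mult.assoc)
  have "(\<Sum>k<?N. cmod (filter_dft2 n \<phi> k) * E k) \<le> (\<Sum>j\<le>2 * n. cmod (filter_dft n \<phi> j) * H j)"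
    unfolding swap by (intro sum_mono mult_right_mono cmod_filter_dft2_le E)
  also have "\<dots> \<le> c_star * g"
  proof (rule capped_sum_le[where K = "18 * s"])
    show "(\<Sum>j\<le>2 * n. cmod (filter_dft n \<phi> j)) \<le> c_star * real (18 * s)"
      by (rule feasibleD[OF \<phi> s])
    show "0 \<le> H j" for j
      unfolding H_def by (intro sum_nonneg mult_nonneg_nonneg dirichlet_nonneg E)
    show "sum H S \<le> g" if "S \<subseteq> {..2 * n}" "card S \<le> 18 * s" for S
      using g[OF that] swap[of "\<lambda>_. 1" S] by simp
  qed (use feasibleD(3)[OF \<phi> s] s c_star_ge in auto)
  finally show ?thesis .
qed

lemma feasible_cmod_filter_dft2_le:
  assumes \<phi>: "feasible s n \<phi>" and s: "s \<ge> 1"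
  shows "cmod (filter_dft2 n \<phi> k) \<le> c_star * (3 + ln (real (18 * s)))"
proof -
  have "(\<Sum>j\<le>2 * n. cmod (filter_dft n \<phi> j) * dirichlet n (int k - 2 * int j)) \<le> c_star * (3 + ln (real (18 * s)))"
  proof (rule capped_sum_le[where K = "18 * s"])
    show "(\<Sum>j\<le>2 * n. cmod (filter_dft n \<phi> j)) \<le> c_star * real (18 * s)"
      by (rule feasibleD[OF \<phi> s])
    show "(\<Sum>j\<in>S. dirichlet n (int k - 2 * int j)) \<le> 3 + ln (real (18 * s))"
      if "S \<subseteq> {..2 * n}" "card S \<le> 18 * s" for S
      using that s by (intro dirichlet_row_sum) auto
  qed (use feasibleD(3)[OF \<phi> s] s c_star_ge dirichlet_nonneg in auto)
  with cmod_filter_dft2_le[of n \<phi> k] show ?thesis by linarith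
qed

section \<open>From optimality to a deterministic risk bound\<close>

lemma seminorm2_power2: "(seminorm2 n u)\<^sup>2 = (\<Sum>t\<in>{- int n..int n}. (cmod (u t))\<^sup>2)"
  unfolding seminorm2_def by (simp add: sum_nonneg)

lemma Xset_conv:
  assumes "\<phi> \<in> Cn n" "x \<in> Xset s w"
  shows "conv \<phi> x \<in> Xset s w"
  using Xset_sum[of "{- int n..int n}" "\<lambda>\<tau> t. x (t - \<tau>)" s w \<phi>] Xset_shift[OF assms(2)]
  by (simp add: conv_Cn[OF assms(1), abs_def])

text \<open>A signal meets only the projection of the noise on the signal space. The weight 1/4 is
  small enough for the squared norm of \<open>z\<close> to be absorbed into the risk later.\<close>

lemma Re_inner_Xset_le:
  fixes \<sigma> :: real
  assumes on: "orthonormal W d u" and fin: "finite W"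
    and z: "\<And>t. t \<in> W \<Longrightarrow> z t = (\<Sum>i<d. (\<Sum>r\<in>W. z r * cnj (u i r)) * u i t)"
    and q: "(\<Sum>i<d. (cmod (\<Sum>t\<in>W. v t * cnj (u i t)))\<^sup>2) \<le> q"
  shows "2 * \<sigma> * Re (\<Sum>t\<in>W. z t * cnj (v t)) \<le> (\<Sum>t\<in>W. (cmod (z t))\<^sup>2) / 4 + 4 * \<sigma>\<^sup>2 * q"
proof -
  define c where "c i = (\<Sum>r\<in>W. z r * cnj (u i r))" for i
  define p where "p i = (\<Sum>r\<in>W. v r * cnj (u i r))" for i
  have "(\<Sum>t\<in>W. z t * cnj (v t)) = (\<Sum>t\<in>W. (\<Sum>i<d. c i * u i t) * cnj (v t))"
    using z by (intro sum.cong) (auto simp: c_def)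
  also have "\<dots> = (\<Sum>i<d. c i * cnj (p i))"
    unfolding p_def cnj_sum sum_distrib_left sum_distrib_right
    by (subst sum.swap) (simp add: mult_ac)
  finally have "2 * \<sigma> * Re (\<Sum>t\<in>W. z t * cnj (v t)) = (\<Sum>i<d. 2 * \<sigma> * Re (c i * cnj (p i)))"
    by (simp only: Re_sum sum_distrib_left)
  also have "\<dots> \<le> (\<Sum>i<d. (cmod (c i))\<^sup>2 / 4 + 4 * \<sigma>\<^sup>2 * (cmod (p i))\<^sup>2)"
  proof (rule sum_mono)
    fix i
    have "0 \<le> (cmod (c i / 2 - 2 * of_real \<sigma> * p i))\<^sup>2" by simp
    also have "\<dots> = (cmod (c i))\<^sup>2 / 4 + 4 * \<sigma>\<^sup>2 * (cmod (p i))\<^sup>2 - 2 * \<sigma> * Re (c i * cnj (p i))"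
      unfolding cmod_power2 by (simp add: power2_eq_square algebra_simps)
    finally show "2 * \<sigma> * Re (c i * cnj (p i)) \<le> (cmod (c i))\<^sup>2 / 4 + 4 * \<sigma>\<^sup>2 * (cmod (p i))\<^sup>2"
      by simp
  qed
  also have "\<dots> = (\<Sum>i<d. (cmod (c i))\<^sup>2) / 4 + 4 * \<sigma>\<^sup>2 * (\<Sum>i<d. (cmod (p i))\<^sup>2)"
    by (simp add: sum.distrib sum_distrib_left sum_divide_distrib)
  also have "\<dots> \<le> (\<Sum>t\<in>W. (cmod (z t))\<^sup>2) / 4 + 4 * \<sigma>\<^sup>2 * q"
    using orthonormal_bessel[OF on, of z] q
    by (intro add_mono divide_right_mono mult_left_mono) (auto simp: c_def p_def)
  finally show ?thesis .
qed

text \<open>Here \<open>v\<close> is one realization of the noise. In the comparison of the two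
  residuals the noise energy cancels; since the oracle reproduces \<open>x\<close>, its side
  contains noise terms only.\<close>

lemma oracle_inequality:
  fixes \<sigma> :: real
  assumes s: "s \<ge> 1" and x: "x \<in> Xset s w"
    and opt: "optimal s n (\<lambda>t. x t + complex_of_real \<sigma> * v t) \<phi>"
    and \<phi>0: "feasible s n \<phi>0" and rep: "\<And>t. conv \<phi>0 x t = x t"
    and on: "orthonormal {- int n..int n} d u"
    and basis: "\<And>z t. z \<in> Xset s w \<Longrightarrow> t \<in> {- int n..int n} \<Longrightarrow>
       z t = (\<Sum>i<d. (\<Sum>r\<in>{- int n..int n}. z r * cnj (u i r)) * u i t)"
    and q: "(\<Sum>i<d. (cmod (\<Sum>t\<in>{- int n..int n}. v t * cnj (u i t)))\<^sup>2) \<le> q"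
    and g: "\<And>S T. S \<subseteq> {..2 * n} \<Longrightarrow> card S \<le> 18 * s \<Longrightarrow>
      T = {- 2 * int n..2 * int n} \<or> T = {- int n..int n} \<Longrightarrow>
      (\<Sum>k<2 * (2 * n + 1). (\<Sum>j\<in>S. dirichlet n (int k - 2 * int j)) * energy n T v k) \<le> g"
  shows "(seminorm2 n (\<lambda>t. conv \<phi> (\<lambda>t. x t + complex_of_real \<sigma> * v t) t - x t))\<^sup>2
    \<le> \<sigma>\<^sup>2 * (8 * q + 3 * c_star\<^sup>2 * (3 + ln (real (18 * s))) * g + 8 * c_star * g)"
proof -
  let ?W = "{- int n..int n}" and ?I = "{- 2 * int n..2 * int n}" and ?N = "2 * (2 * n + 1)"
  let ?l = "3 + ln (real (18 * s))"
  define y where "y t = x t + complex_of_real \<sigma> * v t" for t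
  define P where "P f = (\<Sum>t\<in>?W. (cmod (f t))\<^sup>2)" for f :: "int \<Rightarrow> complex"
  define Q where "Q f = Re (\<Sum>t\<in>?W. f t * cnj (v t))" for f :: "int \<Rightarrow> complex"
  have \<phi>: "feasible s n \<phi>" and best: "P (\<lambda>t. conv \<phi> y t - y t) \<le> P (\<lambda>t. conv \<phi>0 y t - y t)"
    using opt \<phi>0 unfolding optimal_def P_def seminorm2_power2 y_def by auto
  have conv_y: "conv \<psi> y t = conv \<psi> x t + of_real \<sigma> * conv \<psi> v t" if "feasible s n \<psi>" for \<psi> t
    unfolding conv_Cn[OF feasibleD(1)[OF that s]] y_def
    by (simp add: distrib_left sum.distrib sum_distrib_left mult_ac)
  have quad: "P (conv \<psi> v) \<le> c_star\<^sup>2 * ?l * g" if \<psi>: "feasible s n \<psi>" for \<psi>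
  proof -
    have l0: "?l \<ge> 0" using s by simp
    have "P (conv \<psi> v) \<le> (\<Sum>k<?N. (cmod (filter_dft2 n \<psi> k))\<^sup>2 * energy n ?I v k)"
      unfolding P_def by (rule conv_energy_le[OF feasibleD(1)[OF \<psi> s]])
    also have "\<dots> \<le> (\<Sum>k<?N. (c_star * ?l) * (cmod (filter_dft2 n \<psi> k) * energy n ?I v k))"
      unfolding power2_eq_square mult.assoc[of _ _ "energy n ?I v k" for k]
      by (intro sum_mono mult_right_mono feasible_cmod_filter_dft2_le[OF \<psi> s] mult_nonneg_nonneg energy_nonneg norm_ge_zero)
    also have "\<dots> = c_star * ?l * (\<Sum>k<?N. cmod (filter_dft2 n \<psi> k) * energy n ?I v k)"
      by (rule sum_distrib_left[symmetric])
    also have "\<dots> \<le> c_star * ?l * (c_star * g)"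
      using feasible_energy_le[OF \<psi> s energy_nonneg g] c_star_ge l0
      by (intro mult_left_mono) auto
    finally show ?thesis by (simp add: power2_eq_square mult_ac)
  qed
  have cross: "\<bar>Q (conv \<psi> v)\<bar> \<le> c_star * g" if \<psi>: "feasible s n \<psi>" for \<psi>
  proof -
    have "2 * \<bar>Q (conv \<psi> v)\<bar> \<le> 2 * cmod (\<Sum>t\<in>?W. conv \<psi> v t * cnj (v t))"
      unfolding Q_def by (intro mult_left_mono abs_Re_le_cmod) simp
    also have "\<dots> \<le> (\<Sum>k<?N. cmod (filter_dft2 n \<psi> k) * energy n ?I v k)
        + (\<Sum>k<?N. cmod (filter_dft2 n \<psi> k) * energy n ?W v k)"
      by (rule conv_inner_le[OF feasibleD(1)[OF \<psi> s]])
    also have "\<dots> \<le> c_star * g + c_star * g"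
      by (intro add_mono feasible_energy_le[OF \<psi> s energy_nonneg g]) auto
    finally show ?thesis by simp
  qed
  define r where "r t = conv \<phi> y t - x t" for t
  \<comment> \<open>The error splits into \<open>z\<close>, which is a signal, and filtered
    noise.\<close>
  define z where "z t = conv \<phi> x t - x t" for t
  have r_eq: "r t = z t + of_real \<sigma> * conv \<phi> v t" for t
    by (simp add: r_def z_def conv_y[OF \<phi>])
  have sq: "P (\<lambda>t. f t - of_real a * h t) = P f + a\<^sup>2 * P h - 2 * a * Re (\<Sum>t\<in>?W. f t * cnj (h t))"
    for f h :: "int \<Rightarrow> complex" and a :: real
  proof -
    have "(cmod (f t - of_real a * h t))\<^sup>2 = (cmod (f t))\<^sup>2 + a\<^sup>2 * (cmod (h t))\<^sup>2 - 2 * a * Re (f t * cnj (h t))" for t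
      unfolding cmod_power2 by (simp add: power2_eq_square algebra_simps)
    then show ?thesis
      unfolding P_def Re_sum sum_distrib_left sum.distrib[symmetric] sum_subtractf[symmetric]
      by (intro sum.cong refl)
  qed
  have "P (\<lambda>t. conv \<phi> y t - y t) = P (\<lambda>t. r t - of_real \<sigma> * v t)"
    by (simp add: r_def y_def algebra_simps)
  then have lhs: "P (\<lambda>t. conv \<phi> y t - y t) = P r + \<sigma>\<^sup>2 * P v - 2 * \<sigma> * Q r"
    unfolding sq Q_def .
  have "P (\<lambda>t. conv \<phi>0 y t - y t) = P (\<lambda>t. of_real \<sigma> * (conv \<phi>0 v t - of_real 1 * v t))"
    by (simp add: conv_y[OF \<phi>0] rep y_def algebra_simps)
  also have "\<dots> = \<sigma>\<^sup>2 * P (\<lambda>t. conv \<phi>0 v t - of_real 1 * v t)"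
    unfolding P_def by (simp add: norm_mult power_mult_distrib sum_distrib_left)
  also have "\<dots> = \<sigma>\<^sup>2 * (P (conv \<phi>0 v) + P v - 2 * Q (conv \<phi>0 v))"
    unfolding sq Q_def by simp
  finally have rhs: "P (\<lambda>t. conv \<phi>0 y t - y t) = \<sigma>\<^sup>2 * (P (conv \<phi>0 v) + P v - 2 * Q (conv \<phi>0 v))" .
  have zX: "z \<in> Xset s w"
    unfolding z_def by (intro Xset_diff Xset_conv[OF feasibleD(1)[OF \<phi> s] x] x)
  have zQ: "2 * \<sigma> * Q z \<le> P z / 4 + 4 * \<sigma>\<^sup>2 * q"
    unfolding Q_def P_def by (rule Re_inner_Xset_le[OF on _ basis[OF zX] q]) auto
  have "P z \<le> 2 * P r + 2 * (\<sigma>\<^sup>2 * P (conv \<phi> v))"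
  proof -
    have "(cmod (z t))\<^sup>2 \<le> 2 * (cmod (r t))\<^sup>2 + 2 * (\<sigma>\<^sup>2 * (cmod (conv \<phi> v t))\<^sup>2)" for t
    proof -
      have zr: "z t = r t - of_real \<sigma> * conv \<phi> v t" by (simp add: r_eq)
      have "0 \<le> (cmod (r t + of_real \<sigma> * conv \<phi> v t))\<^sup>2" by simp
      then show ?thesis
        unfolding zr cmod_power2 by (simp add: power2_eq_square algebra_simps)
    qed
    then show ?thesis
      unfolding P_def sum_distrib_left sum.distrib[symmetric] by (intro sum_mono) auto
  qed
  moreover have "2 * \<sigma> * Q r = 2 * \<sigma> * Q z + 2 * \<sigma>\<^sup>2 * Q (conv \<phi> v)"
    unfolding Q_def r_eq by (simp add: distrib_right sum.distrib sum_distrib_left power2_eq_square algebra_simps)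
  moreover have "\<sigma>\<^sup>2 * P (conv \<phi> v) \<le> \<sigma>\<^sup>2 * (c_star\<^sup>2 * ?l * g)"
    by (intro mult_left_mono quad \<phi>) auto
  moreover have "\<sigma>\<^sup>2 * P (conv \<phi>0 v) \<le> \<sigma>\<^sup>2 * (c_star\<^sup>2 * ?l * g)"
    by (intro mult_left_mono quad \<phi>0) auto
  moreover have "\<sigma>\<^sup>2 * Q (conv \<phi> v) \<le> \<sigma>\<^sup>2 * (c_star * g)"
    using cross[OF \<phi>] by (intro mult_left_mono) auto
  moreover have "\<sigma>\<^sup>2 * - Q (conv \<phi>0 v) \<le> \<sigma>\<^sup>2 * (c_star * g)"
    using cross[OF \<phi>0] by (intro mult_left_mono) auto
  \<comment> \<open>The term \<open>P z / 4\<close> costs \<open>P r / 2\<close>. Moving it over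
    doubles the rest: 8 for \<open>q\<close>, 1 + 2 for the quadratic terms of the estimated and the
    oracle filter, 4 + 4 for the cross terms.\<close>
  ultimately have "P r \<le> 8 * (\<sigma>\<^sup>2 * q) + 3 * (\<sigma>\<^sup>2 * (c_star\<^sup>2 * ?l * g)) + 8 * (\<sigma>\<^sup>2 * (c_star * g))"
    using best zQ unfolding lhs rhs by (simp add: algebra_simps)
  then show ?thesis
    unfolding seminorm2_power2 P_def r_def y_def[symmetric] by (simp add: algebra_simps)
qed

text \<open>Pure arithmetic: \<open>D\<close> is \<open>ln (1 / \<delta>)\<close>, \<open>t\<close>
  is \<open>ln (3 / \<delta>)\<close>, \<open>l'\<close> is \<open>3 + ln (18 * s)\<close> and
  \<open>L\<close> is the logarithmic factor of the final bound.\<close>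

lemma oracle_bound_le_risk_bound:
  fixes s l D L c t q :: real
  assumes "s \<ge> 1" "l \<ge> 0" "D \<ge> 0" "L \<ge> 6" "c \<ge> 25" "t \<le> 2 + D" "q \<le> 2 * s + 2 * t"
    and g: "g = 2 * (18 * s * (5 + l)) + 2 * L * (18 * s * l + t)" and t: "t \<ge> 0" and l': "0 \<le> l'" "l' \<le> L"
  shows "8 * q + 3 * c\<^sup>2 * l' * g + 8 * c * g \<le> 80 * c\<^sup>2 * (3 * s * l + 10 * s + D) * L\<^sup>2"
proof -
  \<comment> \<open>From \<open>36 <= 6 * L\<close> come \<open>30 * s + 6 * s * l\<close>; from
    \<open>t <= 2 * s + D\<close> come \<open>36 * s * l + 4 * s + 2 * D\<close>.\<close>
  define a where "a = 34 * s + 42 * (s * l) + 2 * D"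
  have sl: "s * l \<ge> 0" using assms by simp
  have a0: "a \<ge> 0" using assms sl by (simp add: a_def)
  have "36 * (s * (5 + l)) \<le> 6 * L * (s * (5 + l))"
    using assms by (intro mult_right_mono) auto
  moreover have "2 * L * (18 * s * l + t) \<le> 2 * L * (18 * s * l + (2 * s + D))"
    using assms by (intro mult_left_mono add_left_mono) auto
  ultimately have gL: "g \<le> L * a"
    unfolding g a_def by (simp add: algebra_simps)
  have g0: "g \<ge> 0" unfolding g using assms by auto
  have cc: "c\<^sup>2 \<ge> 0" by simp
  have cL: "8 * c \<le> c\<^sup>2 * L"
  proof -
    have "8 * c \<le> (c * L) * c" using assms mult_mono[of 25 c 6 L] by (intro mult_right_mono) auto
    then show ?thesis by (simp add: power2_eq_square mult_ac)
  qed
  have "3 * c\<^sup>2 * l' * g + 8 * c * g \<le> 3 * c\<^sup>2 * L * g + c\<^sup>2 * L * g"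
    using l' g0 cL by (intro add_mono mult_right_mono mult_left_mono) auto
  also have "\<dots> = 4 * c\<^sup>2 * L * g" by simp
  also have "\<dots> \<le> 4 * c\<^sup>2 * L * (L * a)" using gL assms by (intro mult_left_mono) auto
  also have "\<dots> = c\<^sup>2 * L\<^sup>2 * (4 * a)" by (simp add: power2_eq_square)
  finally have 1: "3 * c\<^sup>2 * l' * g + 8 * c * g \<le> c\<^sup>2 * L\<^sup>2 * (4 * a)" .
  have "1 \<le> c\<^sup>2 * L\<^sup>2"
    using assms mult_mono[of 1 "c\<^sup>2" 1 "L\<^sup>2"] by (simp add: one_le_power)
  then have "8 * (6 * s + 2 * D) \<le> c\<^sup>2 * L\<^sup>2 * (8 * (6 * s + 2 * D))"
    using assms mult_right_mono[of 1 "c\<^sup>2 * L\<^sup>2" "8 * (6 * s + 2 * D)"] by simp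
  moreover have "8 * q \<le> 8 * (6 * s + 2 * D)" using assms by simp
  ultimately have "8 * q + 3 * c\<^sup>2 * l' * g + 8 * c * g \<le> c\<^sup>2 * L\<^sup>2 * (8 * (6 * s + 2 * D) + 4 * a)"
    using 1 by (simp only: distrib_left)
  \<comment> \<open>The bracket equals \<open>184 * s + 168 * s * l + 24 * D\<close>.\<close>
  also have "\<dots> \<le> c\<^sup>2 * L\<^sup>2 * (80 * (3 * s * l + 10 * s + D))"
    using assms sl unfolding a_def by (intro mult_left_mono) auto
  finally show ?thesis by (simp add: mult_ac)
qed

text \<open>The factor equals \<open>4 + ln 9 + ln s\<close>; it exceeds
  \<open>3 + ln (18 * s)\<close> because \<open>ln 2 <= 1\<close>, and 6 because
  \<open>exp 2 <= 9\<close>.\<close>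

lemma log_factor_ge:
  assumes "s \<ge> 1"
  shows "3 + ln (real (18 * s)) \<le> ln (9 * exp 4 * real s)" "6 \<le> ln (9 * exp 4 * real s)"
proof -
  have s: "real s \<ge> 1" using assms by simp
  have eq: "ln (9 * exp 4 * real s) = 4 + ln 9 + ln (real s)"
    using s by (simp add: ln_mult_pos)
  have "ln (real (18 * s)) = ln 2 + ln 9 + ln (real s)"
    using s ln_mult_pos[of 2 9] by (simp add: ln_mult_pos)
  then show "3 + ln (real (18 * s)) \<le> ln (9 * exp 4 * real s)"
    using eq ln_le_minus_one[of 2] by simp
  have "exp (1::real) * exp 1 \<le> 3 * 3"
    using exp_le by (intro mult_mono) auto
  then have "exp (2::real) \<le> 9" by (simp flip: exp_add)
  then have "2 \<le> ln (9::real)" by (simp add: ln_ge_iff)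
  then show "6 \<le> ln (9 * exp 4 * real s)" using eq ln_ge_zero[OF s] by simp
qed

text \<open>A nonempty set of at most \<open>K\<close> elements is the image of a map from
  \<open>K\<close> points, an enumeration padded by repeating \<open>h 0\<close>. This crude count
  makes the union bound cost \<open>K\<close> times the logarithm of \<open>card A\<close>.\<close>

lemma card_bounded_subsets_le:
  assumes "finite A" "K \<ge> 1"
  shows "card {S. S \<subseteq> A \<and> S \<noteq> {} \<and> card S \<le> K} \<le> card A ^ K"
proof -
  have "{S. S \<subseteq> A \<and> S \<noteq> {} \<and> card S \<le> K} \<subseteq> (\<lambda>f. f ` {..<K}) ` ({..<K} \<rightarrow>\<^sub>E A)"
  proof
    fix S assume "S \<in> {S. S \<subseteq> A \<and> S \<noteq> {} \<and> card S \<le> K}"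
    then have S: "S \<subseteq> A" "S \<noteq> {}" "card S \<le> K" by auto
    then have finS: "finite S" using assms(1) finite_subset by blast
    obtain h where h: "bij_betw h {0..<card S} S"
      using ex_bij_betw_nat_finite[OF finS] by blast
    have pos: "card S > 0" using S finS by (simp add: card_gt_0_iff)
    define f where "f = restrict (\<lambda>i. if i < card S then h i else h 0) {..<K}"
    have hS: "h ` {0..<card S} = S" using h by (simp add: bij_betw_def)
    have "f ` {..<K} = S"
    proof
      show "f ` {..<K} \<subseteq> S" using hS pos by (auto simp: f_def)
      show "S \<subseteq> f ` {..<K}"
      proof
        fix y assume "y \<in> S"
        then obtain i where "i < card S" "y = h i" using hS by (metis atLeastLessThan_iff imageE)
        then show "y \<in> f ` {..<K}" using S(3) by (intro image_eqI[of _ _ i]) (auto simp: f_def)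
      qed
    qed
    moreover have "f \<in> {..<K} \<rightarrow>\<^sub>E A"
    proof (rule PiE_I)
      fix i assume "i \<in> {..<K}"
      with \<open>f ` {..<K} = S\<close> S(1) show "f i \<in> A" by auto
    qed (simp add: f_def)
    ultimately show "S \<in> (\<lambda>f. f ` {..<K}) ` ({..<K} \<rightarrow>\<^sub>E A)" by blast
  qed
  then have "card {S. S \<subseteq> A \<and> S \<noteq> {} \<and> card S \<le> K} \<le> card ((\<lambda>f. f ` {..<K}) ` ({..<K} \<rightarrow>\<^sub>E A))"
    using assms by (intro card_mono finite_imageI finite_PiE) auto
  also have "\<dots> \<le> card ({..<K} \<rightarrow>\<^sub>E A)"
    using assms by (intro card_image_le finite_PiE) auto
  also have "\<dots> = card A ^ K" by (simp add: card_PiE)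
  finally show ?thesis .
qed

text \<open>The periodogram is a sum of squares with the scaled characters as rows; Parseval on the
  grid shows them contractive.\<close>

lemma (in prob_space) energy_tail:
  fixes \<xi> :: "int \<Rightarrow> 'a \<Rightarrow> complex"
  assumes indep: "indep_vars (\<lambda>_. borel) \<xi> T"
    and gauss: "\<And>t. t \<in> T \<Longrightarrow> distr M borel (\<xi> t) = std_complex_gaussian"
    and T: "T \<subseteq> {- 2 * int n..2 * int n}"
    and L: "0 < L" and w: "\<And>k. 0 \<le> w k \<and> w k \<le> L"
  shows "prob {\<omega>\<in>space M. (\<Sum>k<2 * (2 * n + 1). w k * energy n T (\<lambda>t. \<xi> t \<omega>) k)
      \<ge> 2 * (\<Sum>k<2 * (2 * n + 1). w k) + 2 * L * r} \<le> exp (- r)"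
proof -
  let ?N = "2 * (2 * n + 1)"
  define U where "U k t = chi ?N (- (int k * t)) / of_real (sqrt (real ?N))" for k t
  have finT: "finite T" using T finite_subset by blast
  have en: "energy n T v k = (cmod (\<Sum>t\<in>T. U k t * v t))\<^sup>2" for v k
  proof -
    have "(\<Sum>t\<in>T. U k t * v t) = (\<Sum>t\<in>T. v t * chi ?N (- (int k * t))) / of_real (sqrt (real ?N))"
      unfolding U_def sum_divide_distrib by (simp only: times_divide_eq_left times_divide_eq_right mult.commute)
    then have "(cmod (\<Sum>t\<in>T. U k t * v t))\<^sup>2
        = (cmod (\<Sum>t\<in>T. v t * chi ?N (- (int k * t))))\<^sup>2 / (sqrt (real ?N))\<^sup>2"
      by (simp only: norm_divide power_divide norm_of_real power2_abs)
    then show ?thesis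
      unfolding energy_def by (simp only: real_sqrt_pow2[OF of_nat_0_le_iff])
  qed
  show ?thesis
    unfolding en
  proof (rule gaussian_quadratic_tail[OF finT _ indep gauss L w])
    fix g :: "nat \<Rightarrow> complex"
    \<comment> \<open>Conjugation turns the negative frequencies in \<open>U\<close> into the
      positive ones of \<open>parseval_chi_grid\<close>.\<close>
    have eq: "cmod (\<Sum>k<?N. g k * U k t) = cmod (\<Sum>k<?N. cnj (g k) / of_real (sqrt (real ?N)) * chi ?N (int k * t))" for t
    proof -
      have "cnj (\<Sum>k<?N. g k * U k t) = (\<Sum>k<?N. cnj (g k) / of_real (sqrt (real ?N)) * chi ?N (int k * t))"
        unfolding U_def cnj_sum complex_cnj_mult complex_cnj_divide cnj_chi complex_cnj_complex_of_real minus_minus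
        by (simp only: times_divide_eq_left times_divide_eq_right)
      then show ?thesis by (metis complex_mod_cnj)
    qed
    have "{- 2 * int n..2 * int n} \<subseteq> {- 2 * int n..<- 2 * int n + int ?N}" by auto
    with T have TW: "T \<subseteq> {- 2 * int n..<- 2 * int n + int ?N}" by (rule order_trans)
    have "(\<Sum>t\<in>T. (cmod (\<Sum>k<?N. g k * U k t))\<^sup>2)
        \<le> real ?N * (\<Sum>k<?N. (cmod (cnj (g k) / of_real (sqrt (real ?N))))\<^sup>2)"
      unfolding eq by (rule parseval_chi_grid[OF _ TW]) simp
    also have "\<dots> = (\<Sum>k<?N. (cmod (g k))\<^sup>2)"
      unfolding norm_divide norm_of_real power_divide power2_abs real_sqrt_pow2[OF of_nat_0_le_iff]
        complex_mod_cnj sum_divide_distrib[symmetric]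
      by (simp del: of_nat_Suc of_nat_add of_nat_mult sum.lessThan_Suc)
    finally show "(\<Sum>t\<in>T. (cmod (\<Sum>k<?N. g k * U k t))\<^sup>2) \<le> (\<Sum>k<?N. (cmod (g k))\<^sup>2)" .
  qed auto
qed

theorem theorem3:
  fixes M :: "'a measure" and \<xi> :: "int \<Rightarrow> 'a \<Rightarrow> complex"
    and s m n :: nat and w :: "nat \<Rightarrow> complex" and x :: "int \<Rightarrow> complex"
    and \<sigma> \<delta> :: real
  assumes "prob_space M"
    and "s \<ge> 1" and "m \<ge> s - 1" and "n = 9 * m"
    and "x \<in> Xset s w"
    and "\<sigma> \<ge> 0"
    and "prob_space.indep_vars M (\<lambda>_. borel) \<xi> {- 2 * int n..2 * int n}"
    and "\<And>t. t \<in> {- 2 * int n..2 * int n} \<Longrightarrow> distr M borel (\<xi> t) = std_complex_gaussian"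
    and "0 < \<delta>" and "\<delta> < 1"
  shows "\<exists>A\<in>sets M. measure M A \<ge> 1 - \<delta> \<and>
    (\<forall>\<omega>\<in>A. \<forall>\<phi>. optimal s n (\<lambda>t. x t + complex_of_real \<sigma> * \<xi> t \<omega>) \<phi> \<longrightarrow>
       (seminorm2 n (\<lambda>t. conv \<phi> (\<lambda>t. x t + complex_of_real \<sigma> * \<xi> t \<omega>) t - x t))\<^sup>2
       \<le> 80 * c_star\<^sup>2 * \<sigma>\<^sup>2 * (3 * real s * ln (2 * real n + 1) + 10 * real s + ln (1 / \<delta>))
           * (ln (9 * exp 4 * real s))\<^sup>2)"
proof -
  interpret prob_space M by fact
  let ?I = "{- 2 * int n..2 * int n}" and ?W = "{- int n..int n}" and ?N = "2 * (2 * n + 1)"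
  note s = \<open>s \<ge> 1\<close> and x = \<open>x \<in> Xset s w\<close> and indep = assms(7) and gauss = assms(8)
  define L where "L = ln (9 * exp 4 * real s)"
  define K where "K = 18 * s"
  define l where "l = ln (real (2 * n + 1))"
  \<comment> \<open>Three bad events share the failure probability: the two noise windows and the
    projection on the signal space.\<close>
  define t where "t = ln (3 / \<delta>)"
  define D where "D = ln (1 / \<delta>)"
  \<comment> \<open>The first summand pays for the union over at most \<open>(2 * n + 1) ^ K\<close>
    kernel sets; the second leaves probability \<open>\<delta> / 3\<close>.\<close>
  define r where "r = real K * l + t"
  define g where "g = 2 * (real K * (5 + l)) + 2 * L * r"
  have L6: "L \<ge> 6" and L3: "3 + ln (real K) \<le> L"
    unfolding L_def K_def using log_factor_ge[OF s] by auto
  have l0: "l \<ge> 0" by (simp add: l_def)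
  have D0: "D \<ge> 0" using assms by (simp add: D_def)
  have tD: "t = ln 3 + D" using \<open>0 < \<delta>\<close> by (simp add: t_def D_def ln_div)
  have ln3: "0 \<le> ln (3::real)" "ln (3::real) \<le> 2" using ln_le_minus_one[of 3] by auto
  have K1: "K \<ge> 1" using s by (simp add: K_def)
  have exp_t: "exp (- t) = \<delta> / 3"
    using \<open>0 < \<delta>\<close> by (simp add: t_def exp_minus)
  have g0: "g \<ge> 0"
    unfolding g_def r_def using L6 l0 ln3 D0 by (auto simp: tD)
  have \<xi>m[measurable]: "\<xi> t \<in> borel_measurable M" if "t \<in> ?I" for t
    using indep that by (auto simp: indep_vars_def)

  obtain \<phi>0 where \<phi>0: "\<phi>0 \<in> Cn n" and rep: "\<And>x t. x \<in> Xset s w \<Longrightarrow> conv \<phi>0 x t = x t"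
    and spec1: "\<And>k. cmod (filter_dft n \<phi>0 k) \<le> 1"
    and spec2: "(\<Sum>k\<le>2 * n. cmod (filter_dft n \<phi>0 k)) \<le> real (2 * n + 1) * real s / real (2 * m + 1)"
    by (rule reproducing_filter[where m = m and n = n and s = s and w = w]) (use \<open>n = 9 * m\<close> in auto)
  have feas: "feasible s n \<phi>0"
  proof (rule feasibleI[OF \<phi>0])
    show "cmod (filter_dft n \<phi>0 k) \<le> c_star" for k
      using spec1[of k] c_star_ge by simp
    have "real (2 * n + 1) * real s \<le> real (9 * (2 * m + 1)) * real s"
      using \<open>n = 9 * m\<close> by (intro mult_right_mono) auto
    then have "real (2 * n + 1) * real s / real (2 * m + 1) \<le> 9 * real s"
      by (simp add: divide_le_eq mult_ac)
    also have "\<dots> \<le> 25 * real (18 * s)" by simp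
    also have "\<dots> \<le> c_star * real (18 * s)"
      using c_star_ge by (intro mult_right_mono) auto
    finally show "(\<Sum>k\<le>2 * n. cmod (filter_dft n \<phi>0 k)) \<le> c_star * real (18 * s)"
      using spec2 by simp
  qed

  obtain d u where d: "d \<le> s" and on: "orthonormal ?W d u"
    and basis: "\<And>x t. x \<in> Xset s w \<Longrightarrow> t \<in> ?W \<Longrightarrow>
       x t = (\<Sum>i<d. (\<Sum>r\<in>?W. x r * cnj (u i r)) * u i t)"
    by (rule Xset_orthonormal_basis[where s = s and w = w and a = "- int n" and b = "int n"]) blast

  \<comment> \<open>The empty set is left out to suit the counting lemma; its weighted energy is 0,
    which \<open>g0\<close> covers.\<close>
  define F where "F = {S. S \<subseteq> {..2 * n} \<and> S \<noteq> {} \<and> card S \<le> K}"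
  define wt where "wt S k = (\<Sum>j\<in>S. dirichlet n (int k - 2 * int j))" for S k
  define B where "B T S = {\<omega>\<in>space M. (\<Sum>k<?N. wt S k * energy n T (\<lambda>t. \<xi> t \<omega>) k)
      \<ge> 2 * (\<Sum>k<?N. wt S k) + 2 * L * r}" for T S
  \<comment> \<open>The factors 1 are the weights and the scale in
    \<open>gaussian_quadratic_tail\<close>.\<close>
  define C where "C = {\<omega>\<in>space M. (\<Sum>i<d. 1 * (cmod (\<Sum>t\<in>?W. cnj (u i t) * \<xi> t \<omega>))\<^sup>2)
      \<ge> 2 * (\<Sum>i<d. 1) + 2 * 1 * t}"
  have finF: "finite F" by (simp add: F_def)
  have cardF: "real (card F) \<le> real (2 * n + 1) ^ K"
  proof -
    have "card F \<le> (2 * n + 1) ^ K"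
      using card_bounded_subsets_le[of "{..2 * n}" K] K1 by (simp add: F_def)
    then show ?thesis unfolding of_nat_power[symmetric] of_nat_le_iff .
  qed
  have WI: "?W \<subseteq> ?I" by auto
  have Bm[measurable]: "B T S \<in> sets M" if "T \<subseteq> ?I" for T S
  proof -
    have "\<xi> t \<in> borel_measurable M" if "t \<in> T" for t using that \<open>T \<subseteq> ?I\<close> by auto
    note [measurable] = this
    show ?thesis unfolding B_def energy_def by measurable
  qed
  have Cm[measurable]: "C \<in> sets M"
  proof -
    have "\<xi> t \<in> borel_measurable M" if "t \<in> ?W" for t using that by auto
    note [measurable] = this
    show ?thesis unfolding C_def by measurable
  qed
  have PB: "prob (B T S) \<le> exp (- r)" if T: "T \<subseteq> ?I" and S: "S \<in> F" for T S
    unfolding B_def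
  proof (rule energy_tail[OF _ _ T])
    show "indep_vars (\<lambda>_. borel) \<xi> T" using indep T by (rule indep_vars_subset)
    show "distr M borel (\<xi> t) = std_complex_gaussian" if "t \<in> T" for t using that T gauss by auto
    show "0 \<le> wt S k \<and> wt S k \<le> L" for k
    proof
      show "0 \<le> wt S k" unfolding wt_def by (intro sum_nonneg dirichlet_nonneg)
      show "wt S k \<le> L"
        using dirichlet_row_sum[of S n K k] S K1 L3 unfolding wt_def F_def by auto
    qed
  qed (use L6 in simp)
  have PBU: "prob (\<Union>S\<in>F. B T S) \<le> \<delta> / 3" if T: "T \<subseteq> ?I" for T
  proof -
    have "prob (\<Union>S\<in>F. B T S) \<le> (\<Sum>S\<in>F. prob (B T S))"
      using Bm[OF T] finF by (intro finite_measure_subadditive_finite) auto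
    also have "\<dots> \<le> (\<Sum>S\<in>F. exp (- r))" using PB[OF T] by (rule sum_mono)
    also have "\<dots> = real (card F) * exp (- r)" by simp
    also have "\<dots> \<le> real (2 * n + 1) ^ K * exp (- r)" using cardF by (rule mult_right_mono) simp
    also have "real (2 * n + 1) ^ K = exp (real K * l)"
      unfolding l_def by (subst exp_of_nat_mult) simp
    also have "exp (real K * l) * exp (- r) = exp (- t)" by (simp add: r_def flip: exp_add)
    finally show ?thesis by (simp add: exp_t)
  qed
  have PC: "prob C \<le> \<delta> / 3"
    unfolding C_def exp_t[symmetric]
  proof (rule gaussian_quadratic_tail)
    show "indep_vars (\<lambda>_. borel) \<xi> ?W" using indep WI by (rule indep_vars_subset)
    show "distr M borel (\<xi> t) = std_complex_gaussian" if "t \<in> ?W" for t using that WI gauss by auto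
    fix h :: "nat \<Rightarrow> complex"
    have "cmod (\<Sum>i<d. h i * cnj (u i t)) = cmod (\<Sum>i<d. cnj (h i) * u i t)" for t
    proof -
      have "cnj (\<Sum>i<d. h i * cnj (u i t)) = (\<Sum>i<d. cnj (h i) * u i t)" by simp
      then show ?thesis by (metis complex_mod_cnj)
    qed
    then show "(\<Sum>t\<in>?W. (cmod (\<Sum>i<d. h i * cnj (u i t)))\<^sup>2) \<le> (\<Sum>i<d. (cmod (h i))\<^sup>2)"
      using orthonormal_pythagoras[OF on, of "\<lambda>i. cnj (h i)"] by simp
  qed auto

  define Bad where "Bad = (\<Union>S\<in>F. B ?I S) \<union> (\<Union>S\<in>F. B ?W S) \<union> C"
  have BU: "(\<Union>S\<in>F. B T S) \<in> sets M" if "T \<subseteq> ?I" for T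
    using Bm[OF that] finF by (intro sets.finite_UN) auto
  have Badm: "Bad \<in> sets M" unfolding Bad_def using BU[OF order_refl] BU[OF WI] Cm by auto
  have "prob Bad \<le> prob ((\<Union>S\<in>F. B ?I S) \<union> (\<Union>S\<in>F. B ?W S)) + prob C"
    unfolding Bad_def using BU[OF order_refl] BU[OF WI] Cm by (intro measure_Un_le) auto
  also have "prob ((\<Union>S\<in>F. B ?I S) \<union> (\<Union>S\<in>F. B ?W S)) \<le> prob (\<Union>S\<in>F. B ?I S) + prob (\<Union>S\<in>F. B ?W S)"
    using BU[OF order_refl] BU[OF WI] by (intro measure_Un_le) auto
  finally have PBad: "prob Bad \<le> \<delta>"
    using PBU[OF order_refl] PBU[OF WI] PC by simp
  show ?thesis
  \<comment> \<open>The event is fixed by the noise alone, before any minimizer is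
    considered.\<close>
  proof (intro bexI[of _ "space M - Bad"] conjI ballI allI impI)
    show "space M - Bad \<in> sets M" using Badm by auto
    show "1 - \<delta> \<le> prob (space M - Bad)" using PBad Badm by (simp add: prob_compl)
    fix \<omega> \<phi> assume \<omega>: "\<omega> \<in> space M - Bad"
      and opt: "optimal s n (\<lambda>t. x t + complex_of_real \<sigma> * \<xi> t \<omega>) \<phi>"
    have column: "(\<Sum>k<?N. wt S k) \<le> real K * (5 + l)" if "S \<in> F" for S
    proof -
      have "(\<Sum>k<?N. wt S k) = (\<Sum>j\<in>S. \<Sum>k<?N. dirichlet n (int k - 2 * int j))"
        unfolding wt_def by (rule sum.swap)
      also have "\<dots> \<le> (\<Sum>j\<in>S. 5 + l)"
        unfolding l_def by (intro sum_mono dirichlet_column_sum)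
      also have "\<dots> \<le> real K * (5 + l)"
        using that l0 by (simp add: F_def mult_right_mono)
      finally show ?thesis .
    qed
    have gb: "(\<Sum>k<?N. (\<Sum>j\<in>S. dirichlet n (int k - 2 * int j)) * energy n T (\<lambda>t. \<xi> t \<omega>) k) \<le> g"
      if S: "S \<subseteq> {..2 * n}" "card S \<le> 18 * s" and T: "T = ?I \<or> T = ?W" for S T
    proof (cases "S = {}")
      case False
      then have SF: "S \<in> F" using S by (simp add: F_def K_def)
      then have "\<omega> \<notin> B T S" using T \<omega> by (auto simp: Bad_def)
      then have "(\<Sum>k<?N. wt S k * energy n T (\<lambda>t. \<xi> t \<omega>) k) < 2 * (\<Sum>k<?N. wt S k) + 2 * L * r"
        using \<omega> unfolding B_def by (simp only: mem_Collect_eq not_le de_Morgan_conj) simp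
      also have "\<dots> \<le> g" unfolding g_def using column[OF SF] by simp
      finally show ?thesis unfolding wt_def by simp
    qed (use g0 in simp)
    define q where "q = 2 * real d + 2 * t"
    have "\<omega> \<notin> C" using \<omega> by (auto simp: Bad_def)
    then have qb: "(\<Sum>i<d. (cmod (\<Sum>t\<in>?W. \<xi> t \<omega> * cnj (u i t)))\<^sup>2) \<le> q"
      using \<omega> unfolding C_def q_def by (simp add: mult.commute)
    have "(seminorm2 n (\<lambda>t. conv \<phi> (\<lambda>t. x t + complex_of_real \<sigma> * \<xi> t \<omega>) t - x t))\<^sup>2
        \<le> \<sigma>\<^sup>2 * (8 * q + 3 * c_star\<^sup>2 * (3 + ln (real (18 * s))) * g + 8 * c_star * g)"
      by (rule oracle_inequality[OF s x opt feas rep[OF x] on basis qb gb])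
    also have "\<dots> \<le> \<sigma>\<^sup>2 * (80 * c_star\<^sup>2 * (3 * real s * l + 10 * real s + D) * L\<^sup>2)"
    proof (intro mult_left_mono oracle_bound_le_risk_bound[where t = t])
      show "g = 2 * (18 * real s * (5 + l)) + 2 * L * (18 * real s * l + t)"
        by (simp add: g_def r_def K_def)
      show "0 \<le> 3 + ln (real (18 * s))" using s by simp
    qed (use s l0 D0 L6 L3 c_star_ge tD ln3 d in \<open>auto simp: K_def q_def\<close>)
    also have "\<dots> = 80 * c_star\<^sup>2 * \<sigma>\<^sup>2 * (3 * real s * ln (2 * real n + 1) + 10 * real s + ln (1 / \<delta>))
           * (ln (9 * exp 4 * real s))\<^sup>2"
      by (simp add: l_def D_def L_def mult_ac add.commute)
    finally show "(seminorm2 n (\<lambda>t. conv \<phi> (\<lambda>t. x t + complex_of_real \<sigma> * \<xi> t \<omega>) t - x t))\<^sup>2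
       \<le> 80 * c_star\<^sup>2 * \<sigma>\<^sup>2 * (3 * real s * ln (2 * real n + 1) + 10 * real s + ln (1 / \<delta>))
           * (ln (9 * exp 4 * real s))\<^sup>2" .
  qed
qed

end
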